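(* Let $\beta>0$. For any $\kappa>0$, $$\lim_{n\to\infty}\operatorname{ObsDiam}\Big(\frac{1}{\sqrt n}C^n_\beta;-\kappa\Big)=\operatorname{ObsDiam}\big(([0,\infty),|\cdot|,\nu_\beta);-\kappa\big).$$
   Context: An mm-space is a triple $X=(X,d_X,m_X)$ where $(X,d_X)$ is a complete separable metric space and $m_X$ is a Borel probability measure on $X$. For $t>0$, $tX:=(X,t\,d_X,m_X)$. For $\alpha\le1$, the partial diameter $\operatorname{diam}(X;\alpha)$ is the infimum of $\operatorname{diam}A$ over Borel sets $A\subset X$ with $m_X(A)\ge\alpha$ (with $\operatorname{diam}\emptyset=0$). For $\kappa>0$, $\operatorname{ObsDiam}(X;-\kappa):=\sup_f\operatorname{diam}((\mathbb{R},|\cdot|,f_\#m_X);1-\kappa)$, where $f$ runs over all $1$-Lipschitz functions $f:X\to\mathbb{R}$. For $\beta>0$, $C^n_\beta:=(\mathbb{R}^n,\|\cdot\|,\nu^n_\beta)$ with the Euclidean distance and $$\nu^n_\beta(dx)=\frac{\Gamma(\frac{n+\beta}{2})}{\pi^{n/2}\Gamma(\frac\beta2)}\frac{dx}{(1+\|x\|^2)^{\frac{n+\beta}{2}}};$$ $\nu_\beta$ is the Borel probability measure on $[0,\infty)$ $$\nu_\beta(dt)=\frac{2^{1-\frac\beta2}}{\Gamma(\frac\beta2)}\,\frac{1}{t^{\beta+1}}\,e^{-\frac{1}{2t^2}}\,dt .$$ *)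

theory Defs
  imports "HOL-Probability.Probability"
begin

record 'a mm_triple =
  mm_carrier :: "'a set"
  mm_dist :: "'a \<Rightarrow> 'a \<Rightarrow> real"
  mm_meas :: "'a measure"

definition mm_space :: "'a mm_triple \<Rightarrow> bool" where
  "mm_space X \<longleftrightarrow>
     Metric_space (mm_carrier X) (mm_dist X) \<and>
     Metric_space.mcomplete (mm_carrier X) (mm_dist X) \<and>
     separable_space (Metric_space.mtopology (mm_carrier X) (mm_dist X)) \<and>
     space (mm_meas X) = mm_carrier X \<and>
     sets (mm_meas X) =
       sigma_sets (mm_carrier X)
         {U. openin (Metric_space.mtopology (mm_carrier X) (mm_dist X)) U} \<and>
     prob_space (mm_meas X)"

definition mm_scale :: "real \<Rightarrow> 'a mm_triple \<Rightarrow> 'a mm_triple" where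
  "mm_scale t X =
     \<lparr>mm_carrier = mm_carrier X, mm_dist = (\<lambda>x y. t * mm_dist X x y), mm_meas = mm_meas X\<rparr>"

(* Diameters take values in [0, \<infinity>]; the library's real-valued diameter is not
   meaningful on unbounded sets. The supremum over the empty set is 0 in ennreal. *)
definition ediam :: "('a \<Rightarrow> 'a \<Rightarrow> real) \<Rightarrow> 'a set \<Rightarrow> ennreal" where
  "ediam d A = (SUP p\<in>A \<times> A. ennreal (d (fst p) (snd p)))"

definition partial_diam :: "'a mm_triple \<Rightarrow> real \<Rightarrow> ennreal" where
  "partial_diam X \<alpha> =
     (INF A\<in>{A \<in> sets (mm_meas X). measure (mm_meas X) A \<ge> \<alpha>}. ediam (mm_dist X) A)"

definition one_Lipschitz :: "'a mm_triple \<Rightarrow> ('a \<Rightarrow> real) \<Rightarrow> bool" where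
  "one_Lipschitz X f \<longleftrightarrow>
     (\<forall>x\<in>mm_carrier X. \<forall>y\<in>mm_carrier X. \<bar>f x - f y\<bar> \<le> mm_dist X x y)"

definition mm_line :: "real measure \<Rightarrow> real mm_triple" where
  "mm_line \<mu> = \<lparr>mm_carrier = UNIV, mm_dist = (\<lambda>x y. \<bar>x - y\<bar>), mm_meas = \<mu>\<rparr>"

(* obs_diam X \<kappa> is ObsDiam(X; -\<kappa>). *)
definition obs_diam :: "'a mm_triple \<Rightarrow> real \<Rightarrow> ennreal" where
  "obs_diam X \<kappa> =
     (SUP f\<in>{f. one_Lipschitz X f}. partial_diam (mm_line (distr (mm_meas X) borel f)) (1 - \<kappa>))"

(* Since n varies in the limit, R^n is the set of extensional functions on {..<n},
   with L2_set as Euclidean norm and the n-fold product of lborel as Lebesgue measure. *)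
definition cauchy_measure :: "real \<Rightarrow> nat \<Rightarrow> (nat \<Rightarrow> real) measure" where
  "cauchy_measure \<beta> n =
     density (\<Pi>\<^sub>M i\<in>{..<n}. lborel)
       (\<lambda>x. ennreal (Gamma ((real n + \<beta>) / 2) / (pi powr (real n / 2) * Gamma (\<beta> / 2))
              * (1 / (1 + (L2_set x {..<n})\<^sup>2) powr ((real n + \<beta>) / 2))))"

definition cauchy_space :: "real \<Rightarrow> nat \<Rightarrow> (nat \<Rightarrow> real) mm_triple" where
  "cauchy_space \<beta> n =
     \<lparr>mm_carrier = (\<Pi>\<^sub>E i\<in>{..<n}. UNIV),
      mm_dist = (\<lambda>x y. L2_set (\<lambda>i. x i - y i) {..<n}),
      mm_meas = cauchy_measure \<beta> n\<rparr>"

(* At t = 0 the density evaluates to 0 by the convention 1 / 0 = 0. *)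
definition nu :: "real \<Rightarrow> real measure" where
  "nu \<beta> =
     density (restrict_space lborel {0..})
       (\<lambda>t. ennreal (2 powr (1 - \<beta> / 2) / Gamma (\<beta> / 2)
              * (1 / t powr (\<beta> + 1)) * exp (- (1 / (2 * t\<^sup>2)))))"

definition half_line_space :: "real \<Rightarrow> real mm_triple" where
  "half_line_space \<beta> =
     \<lparr>mm_carrier = {0..}, mm_dist = (\<lambda>x y. \<bar>x - y\<bar>), mm_meas = nu \<beta>\<rparr>"

end

(* Let T have law nu_beta and let Z be an independent standard Gaussian vector in R^n. Then T Z has
   law nu^n_beta, so (1 / sqrt n) C^n_beta is the law of T Z / sqrt n. For a 1-Lipschitz f, the
   function z |-> f (t z / sqrt n) is (t / sqrt n)-Lipschitz, hence within O(t / sqrt n) of its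
   Gaussian mean m(t), by a dimension-free variance bound; that bound comes from Maurey's property
   tau, which tensorizes. As E |Z| <= sqrt n, m is 1-Lipschitz on the half-line, so f(T Z / sqrt n) is
   uniformly close to m(T), a 1-Lipschitz image of nu_beta. Conversely, |T Z| / sqrt n is close to T.
   The observable diameter of nu_beta is the partial diameter of nu_beta itself, and it is continuous
   in kappa because intervals are compact and the density is positive on the open half-line. *)

theory Submission
  imports Defs
begin

subsection \<open>Property tau for the Gaussian measure\<close>

text \<open>The concentration estimate is uniform in t only on bounded sets, while T is unbounded;
  this shapes both halves. For the upper bound only T in one fixed interval of length L matters: its
  image under m lies in some interval of length L, whatever f and n are, so no limit of the means is
  taken. For the lower bound the tail of T is cut off by tightness. Each half loses a little mass
  while the target 1 - kappa is fixed. Above, a slightly longer interval has mass strictly larger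
  than 1 - kappa. Below, intervals of mass at least 1 - kappa - epsilon, for every epsilon, yield
  one of mass 1 - kappa in the limit. Property tau says that u(x) v(y) <= exp(|x - y|^2 / 4) forces
  (int u)(int v) <= 1 for Gaussian integrals. It involves no derivatives, so Lipschitz functions
  enter without smoothing, and integrating out one coordinate reproduces its hypothesis, so the
  constant is the same in every dimension. A variance bound is enough: the Lipschitz constants are
  O(1 / sqrt n), and Chebyshev gives probabilities O(1 / n).\<close>

lemma nn_integral_layer_cake:
  fixes f :: "'a \<Rightarrow> real"
  assumes "sigma_finite_measure M" and [measurable]: "f \<in> borel_measurable M" and nn: "\<And>x. 0 \<le> f x"
  shows "(\<integral>\<^sup>+x. ennreal (f x) \<partial>M) =
    (\<integral>\<^sup>+s. emeasure M {x \<in> space M. s < f x} * indicator {0..} s \<partial>lborel)"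
proof -
  interpret sigma_finite_measure M by fact
  interpret pair_sigma_finite M lborel ..
  have "(\<integral>\<^sup>+x. ennreal (f x) \<partial>M) = (\<integral>\<^sup>+x. (\<integral>\<^sup>+s. indicator {0..<f x} s \<partial>lborel) \<partial>M)"
    using nn by simp
  also have "\<dots> = (\<integral>\<^sup>+x. (\<integral>\<^sup>+s. indicator {z. 0 \<le> snd z \<and> snd z < f (fst z)} (x, s) \<partial>lborel) \<partial>M)"
    by (intro nn_integral_cong) (auto simp: indicator_def)
  also have "\<dots> = (\<integral>\<^sup>+s. (\<integral>\<^sup>+x. indicator {z. 0 \<le> snd z \<and> snd z < f (fst z)} (x, s) \<partial>M) \<partial>lborel)"
    by (rule Fubini'[symmetric]) measurable
  also have "\<dots> = (\<integral>\<^sup>+s. (\<integral>\<^sup>+x. indicator {0..} s * indicator {x \<in> space M. s < f x} x \<partial>M) \<partial>lborel)"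
    by (intro nn_integral_cong) (auto simp: indicator_def)
  also have "\<dots> = (\<integral>\<^sup>+s. emeasure M {x \<in> space M. s < f x} * indicator {0..} s \<partial>lborel)"
    by (simp add: nn_integral_cmult mult.commute)
  finally show ?thesis .
qed

text \<open>The one-dimensional Brunn-Minkowski argument with an interval as target: the hypothesis
  forces \<open>Sup A + Sup B \<le> 2 * r\<close> and \<open>Inf A + Inf B \<ge> - 2 * r\<close>, so
  the hulls of \<open>A\<close> and \<open>B\<close> have total length at most
  \<open>4 * r\<close>.\<close>

lemma emeasure_add_le_midpoint_interval:
  fixes A B :: "real set"
  assumes A[measurable]: "A \<in> sets borel" "A \<noteq> {}" and B[measurable]: "B \<in> sets borel" "B \<noteq> {}"
    and mid: "\<And>x y. x \<in> A \<Longrightarrow> y \<in> B \<Longrightarrow> \<bar>x + y\<bar> \<le> 2 * r"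
  shows "emeasure lborel A + emeasure lborel B \<le> 2 * ennreal (2 * r)"
proof -
  obtain a b where a: "a \<in> A" and b: "b \<in> B" using A B by auto
  have bA: "bdd_above A" "bdd_below A"
    using mid[OF _ b] by (force intro!: bdd_aboveI[of _ "2*r - b"], force intro!: bdd_belowI[of _ "-2*r - b"])
  have bB: "bdd_above B" "bdd_below B"
    using mid[OF a] by (force intro!: bdd_aboveI[of _ "2*r - a"], force intro!: bdd_belowI[of _ "-2*r - a"])
  have "Sup A \<le> 2 * r - y" if "y \<in> B" for y
    using mid[OF _ that] A(2) by (intro cSup_least) force+
  hence "y \<le> 2 * r - Sup A" if "y \<in> B" for y using that by force
  hence s: "Sup B \<le> 2 * r - Sup A"
    using B(2) by (intro cSup_least) force+
  have "-2 * r - y \<le> Inf A" if "y \<in> B" for y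
    using mid[OF _ that] A(2) by (intro cInf_greatest) force+
  hence "-2 * r - Inf A \<le> y" if "y \<in> B" for y using that by force
  hence i: "-2 * r - Inf A \<le> Inf B"
    using B(2) by (intro cInf_greatest) force+
  have "A \<subseteq> {Inf A..Sup A}" "B \<subseteq> {Inf B..Sup B}"
    using bA bB by (auto intro: cInf_lower cSup_upper)
  hence "emeasure lborel A \<le> emeasure lborel {Inf A..Sup A}" "emeasure lborel B \<le> emeasure lborel {Inf B..Sup B}"
    by (auto intro!: emeasure_mono)
  moreover have le: "Inf A \<le> Sup A" "Inf B \<le> Sup B"
    using bA bB A B by (auto intro: cInf_le_cSup)
  ultimately have "emeasure lborel A + emeasure lborel B \<le> ennreal (Sup A - Inf A) + ennreal (Sup B - Inf B)"
    by (auto intro: add_mono)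
  also have "\<dots> = ennreal (Sup A - Inf A + (Sup B - Inf B))"
    using le by (simp add: ennreal_plus)
  also have "\<dots> \<le> ennreal (4 * r)"
    using s i by (intro ennreal_leI) linarith
  also have "ennreal (4 * r) = 2 * ennreal (2 * r)"
    by (simp add: ennreal_mult'[symmetric] flip: ennreal_numeral)
  finally show ?thesis .
qed

lemma std_normal_density_less_iff:
  assumes "0 < c"
  shows "c < std_normal_density z \<longleftrightarrow> z\<^sup>2 < - 2 * ln (c * sqrt (2 * pi))"
proof -
  have "c < std_normal_density z \<longleftrightarrow> c * sqrt (2 * pi) < exp (- z\<^sup>2 / 2)"
    by (simp add: std_normal_density_def field_simps)
  also have "\<dots> \<longleftrightarrow> ln (c * sqrt (2 * pi)) < - z\<^sup>2 / 2"
    using assms by (subst ln_less_cancel_iff[symmetric]) auto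
  also have "\<dots> \<longleftrightarrow> z\<^sup>2 < - 2 * ln (c * sqrt (2 * pi))" by auto
  finally show ?thesis .
qed

text \<open>The square root of a negative number is negative here, so the formula also covers levels
  at or above the maximum of the density, where both sides are empty.\<close>

lemma std_normal_level_set:
  assumes "0 < c"
  shows "{z. c < std_normal_density z} = {- sqrt (- 2 * ln (c * sqrt (2 * pi)))<..<sqrt (- 2 * ln (c * sqrt (2 * pi)))}"
    (is "_ = {-?r<..<?r}")
proof -
  have "z\<^sup>2 < t \<longleftrightarrow> \<bar>z\<bar> < sqrt t" for z t :: real
    by (metis real_sqrt_abs real_sqrt_less_iff)
  thus ?thesis unfolding std_normal_density_less_iff[OF assms] by (auto simp: abs_less_iff)
qed

lemma emeasure_std_normal_level_set:
  assumes c: "0 < c" and [measurable]: "A \<in> sets borel" "B \<in> sets borel" and ne: "A \<noteq> {}" "B \<noteq> {}"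
    and mid: "\<And>x y. x \<in> A \<Longrightarrow> y \<in> B \<Longrightarrow> c < std_normal_density ((x + y) / 2)"
  shows "emeasure lborel A + emeasure lborel B \<le> 2 * emeasure lborel {z. c < std_normal_density z}"
proof -
  define r where "r = sqrt (- 2 * ln (c * sqrt (2 * pi)))"
  have lev: "{z. c < std_normal_density z} = {-r<..<r}"
    using std_normal_level_set[OF c] by (simp add: r_def)
  have m: "\<bar>x + y\<bar> < 2 * r" if "x \<in> A" "y \<in> B" for x y
    using mid[OF that] lev by (auto simp: set_eq_iff abs_less_iff)
  \<comment> \<open>A negative \<open>r\<close> would mean an empty level set, which the nonempty
    \<open>A\<close> and \<open>B\<close> exclude.\<close>
  have "0 \<le> r" using m ne by force
  hence "emeasure lborel {z. c < std_normal_density z} = ennreal (2 * r)"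
    unfolding lev by simp
  thus ?thesis using emeasure_add_le_midpoint_interval[of A B r] m ne by (simp add: less_imp_le)
qed

text \<open>The case \<open>\<lambda> = 1/2\<close> of the Prekopa--Leindler inequality against the Gaussian. Its superlevel
  sets are intervals, so only the trivial case of the Brunn--Minkowski inequality is needed.\<close>

lemma prekopa_leindler_std_normal:
  fixes U V :: "real \<Rightarrow> real"
  assumes [measurable]: "U \<in> borel_measurable borel" "V \<in> borel_measurable borel" and c: "0 < c"
    and nn: "\<And>x. 0 \<le> U x" "\<And>x. 0 \<le> V x" and le: "\<And>x. U x \<le> 1" "\<And>x. V x \<le> 1"
    and sup: "\<And>s. s < 1 \<Longrightarrow> \<exists>x. s < U x" "\<And>s. s < 1 \<Longrightarrow> \<exists>x. s < V x"
    and UV: "\<And>x y. U x * V y \<le> (std_normal_density ((x + y) / 2) / c)\<^sup>2"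
  shows "(\<integral>\<^sup>+x. ennreal (U x) \<partial>lborel) + (\<integral>\<^sup>+x. ennreal (V x) \<partial>lborel) \<le> ennreal (2 / c)"
proof -
  define W where "W x = std_normal_density x / c" for x
  have [measurable]: "W \<in> borel_measurable borel" and W0: "0 \<le> W x" for x
    using c by (auto simp: W_def[abs_def])
  have [measurable]: "(\<lambda>s. emeasure lborel {x. s < f x}) \<in> borel_measurable borel"
    if [measurable]: "f \<in> borel_measurable borel" for f :: "real \<Rightarrow> real"
  proof -
    have "(\<lambda>s. emeasure lborel (Pair s -` {z. fst z < f (snd z)})) \<in> borel_measurable (borel :: real measure)"
    proof (rule lborel.measurable_emeasure_Pair)
      have "{z \<in> space (borel \<Otimes>\<^sub>M borel). fst z < f (snd z)} \<in> sets (borel \<Otimes>\<^sub>M (borel :: real measure))"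
        by measurable
      thus "{z. fst z < f (snd z)} \<in> sets (borel \<Otimes>\<^sub>M lborel)"
        by (simp add: space_pair_measure cong: sets_pair_measure_cong)
    qed
    thus ?thesis by (simp add: vimage_def)
  qed
  have layer: "(\<integral>\<^sup>+x. ennreal (f x) \<partial>lborel) = (\<integral>\<^sup>+s. emeasure lborel {x. s < f x} * indicator {0..} s \<partial>lborel)"
    if [measurable]: "f \<in> borel_measurable borel" and "\<And>x. 0 \<le> f x" for f :: "real \<Rightarrow> real"
    using nn_integral_layer_cake[of lborel f] that by (simp add: lborel.sigma_finite_measure_axioms)
  have layer1: "(\<integral>\<^sup>+x. ennreal (f x) \<partial>lborel) = (\<integral>\<^sup>+s. emeasure lborel {x. s < f x} * indicator {0<..<1} s \<partial>lborel)"
    if [measurable]: "f \<in> borel_measurable borel" and "\<And>x. 0 \<le> f x" "\<And>x. f x \<le> 1" for f :: "real \<Rightarrow> real"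
    unfolding layer[OF that(1,2)]
  proof (intro nn_integral_cong_AE)
    have "emeasure lborel {x. s < f x} * indicator {0..} s = emeasure lborel {x. s < f x} * indicator {0<..<1} s"
      if "s \<noteq> 0" for s
    proof (cases "s < 1")
      case False
      hence "{x. s < f x} = {}" using \<open>\<And>x. f x \<le> 1\<close> by (force dest: order.strict_trans2)
      thus ?thesis by simp
    qed (use that in \<open>auto simp: indicator_def\<close>)
    thus "AE s in lborel. emeasure lborel {x. s < f x} * indicator {0..} s = emeasure lborel {x. s < f x} * indicator {0<..<1} s"
      using AE_lborel_singleton[of 0] by (auto elim: eventually_mono)
  qed
  \<comment> \<open>Normalizing both suprema to 1 serves this step: for every \<open>s\<close> in
    (0,1) both level sets are nonempty, as the interval bound requires, and levels
    \<open>s \<ge> 1\<close> contribute nothing to either integral. The geometric mean of two values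
    above \<open>s\<close> is above \<open>s\<close>.\<close>
  have level: "emeasure lborel {x. s < U x} + emeasure lborel {x. s < V x} \<le> 2 * emeasure lborel {x. s < W x}"
    if s: "0 < s" "s < 1" for s
  proof -
    have "{x. s < W x} = {x. s * c < std_normal_density x}" using c by (simp add: W_def field_simps)
    moreover have "s * c < std_normal_density ((x + y) / 2)" if "s < U x" "s < V y" for x y
    proof -
      have "s\<^sup>2 < U x * V y" unfolding power2_eq_square using that s by (intro mult_strict_mono) auto
      also have "\<dots> \<le> (std_normal_density ((x + y) / 2) / c)\<^sup>2" by (rule UV)
      finally have "s < std_normal_density ((x + y) / 2) / c"
        using c by (elim power_less_imp_less_base) auto
      thus ?thesis using c by (simp add: field_simps)
    qed
    ultimately show ?thesis
      using sup[OF s(2)] s c by (auto intro!: emeasure_std_normal_level_set)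
  qed
  have "(\<integral>\<^sup>+x. ennreal (U x) \<partial>lborel) + (\<integral>\<^sup>+x. ennreal (V x) \<partial>lborel) =
    (\<integral>\<^sup>+s. (emeasure lborel {x. s < U x} + emeasure lborel {x. s < V x}) * indicator {0<..<1} s \<partial>lborel)"
    by (subst (1 2) layer1) (auto simp: nn le nn_integral_add distrib_right)
  also have "\<dots> \<le> (\<integral>\<^sup>+s. 2 * (emeasure lborel {x. s < W x} * indicator {0..} s) \<partial>lborel)"
    using level by (intro nn_integral_mono) (auto simp: indicator_def)
  also have "\<dots> = 2 * (\<integral>\<^sup>+x. ennreal (W x) \<partial>lborel)"
    by (simp add: nn_integral_cmult layer W0)
  also have "(\<integral>\<^sup>+x. ennreal (W x) \<partial>lborel) = ennreal (1 / c)"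
    unfolding W_def using c
    by (subst nn_integral_eq_integral) (auto intro!: integrable_normal_density simp: divide_nonneg_pos)
  also have "2 * ennreal (1 / c) = ennreal (2 / c)"
    by (simp add: ennreal_mult'[symmetric] flip: ennreal_numeral)
  finally show ?thesis .
qed

section \<open>The Gaussian property tau: one dimension, then tensorization\<close>

definition std_normal :: "real measure" where
  "std_normal = density lborel (\<lambda>x. ennreal (std_normal_density x))"

lemma sets_std_normal[simp, measurable_cong]: "sets std_normal = sets borel"
  and space_std_normal[simp]: "space std_normal = UNIV"
  by (simp_all add: std_normal_def)

lemma prob_space_std_normal: "prob_space std_normal"
  unfolding std_normal_def by (rule prob_space_normal_density) simp

text \<open>Since \<open>x^2/2 + y^2/2 - (x - y)^2/4 = ((x + y)/2)^2\<close>, the exponent 1/4 is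
  exactly the one for which the densities at \<open>x\<close> and \<open>y\<close> times the bound
  give the squared density at the midpoint. Dividing by the suprema makes the additive
  Prekopa-Leindler bound applicable, and the arithmetic-geometric mean inequality returns it to a
  product.\<close>

lemma gaussian_property_tau_real:
  fixes u v :: "real \<Rightarrow> ennreal"
  assumes [measurable]: "u \<in> borel_measurable borel" "v \<in> borel_measurable borel"
    and uv: "\<And>x y. u x * v y \<le> ennreal (exp ((x - y)\<^sup>2 / 4))"
  shows "(\<integral>\<^sup>+x. u x \<partial>std_normal) * (\<integral>\<^sup>+x. v x \<partial>std_normal) \<le> 1"
proof -
  define U V where "U x = ennreal (std_normal_density x) * u x" and "V x = ennreal (std_normal_density x) * v x" for x
  have [measurable]: "U \<in> borel_measurable borel" "V \<in> borel_measurable borel"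
    by (simp_all add: U_def[abs_def] V_def[abs_def])
  have int: "(\<integral>\<^sup>+x. u x \<partial>std_normal) = (\<integral>\<^sup>+x. U x \<partial>lborel)" "(\<integral>\<^sup>+x. v x \<partial>std_normal) = (\<integral>\<^sup>+x. V x \<partial>lborel)"
    by (simp_all add: std_normal_def nn_integral_density U_def V_def)
  have UV: "U x * V y \<le> ennreal ((std_normal_density ((x + y) / 2))\<^sup>2)" for x y
  proof -
    have "U x * V y = ennreal (std_normal_density x * std_normal_density y) * (u x * v y)"
      by (simp add: U_def V_def ennreal_mult mult_ac)
    also have "\<dots> \<le> ennreal (std_normal_density x * std_normal_density y) * ennreal (exp ((x - y)\<^sup>2 / 4))"
      by (intro mult_left_mono uv) auto
    also have "\<dots> = ennreal (std_normal_density x * std_normal_density y * exp ((x - y)\<^sup>2 / 4))"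
      by (simp add: ennreal_mult)
    also have "std_normal_density x * std_normal_density y * exp ((x - y)\<^sup>2 / 4)
        = (1 / sqrt (2 * pi))\<^sup>2 * (exp (- x\<^sup>2 / 2) * exp (- y\<^sup>2 / 2) * exp ((x - y)\<^sup>2 / 4))"
      by (simp add: std_normal_density_def power2_eq_square)
    also have "exp (- x\<^sup>2 / 2) * exp (- y\<^sup>2 / 2) * exp ((x - y)\<^sup>2 / 4) = (exp (- ((x + y) / 2)\<^sup>2 / 2))\<^sup>2"
      unfolding power2_eq_square exp_add[symmetric] by (rule arg_cong[where f=exp]) (simp add: field_simps)
    also have "(1 / sqrt (2 * pi))\<^sup>2 * (exp (- ((x + y) / 2)\<^sup>2 / 2))\<^sup>2 = (std_normal_density ((x + y) / 2))\<^sup>2"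
      unfolding std_normal_density_def power_mult_distrib ..
    finally show ?thesis .
  qed
  define a b where "a = (SUP x. U x)" and "b = (SUP x. V x)"
  have Ua: "U x \<le> a" and Vb: "V x \<le> b" for x
    by (auto simp: a_def b_def intro: SUP_upper)
  \<comment> \<open>The normal density is at most 1. The bound is needed for finiteness: once
    \<open>a\<close> and \<open>b\<close> are nonzero, neither can be infinite.\<close>
  have "U x * V y \<le> 1" for x y
  proof -
    have "std_normal_density z \<le> 1" for z
    proof -
      have "exp (- z\<^sup>2 / 2) \<le> 1" "1 \<le> sqrt (2 * pi)" using pi_gt3 by auto
      thus ?thesis unfolding std_normal_density_def using mult_mono[of "1 / sqrt (2*pi)" 1 "exp (- z\<^sup>2 / 2)" 1] by simp
    qed
    hence "(std_normal_density ((x + y) / 2))\<^sup>2 \<le> 1" by (simp add: power_le_one)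
    thus ?thesis using UV[of x y] by (metis ennreal_1 ennreal_leI order_trans)
  qed
  hence "a * b \<le> 1"
    unfolding a_def b_def SUP_mult_left_ennreal SUP_mult_right_ennreal by (intro SUP_least)
  show ?thesis
  \<comment> \<open>If one supremum is 0, the other may be infinite and cannot be normalized; but
    then one of the integrals vanishes.\<close>
  proof (cases "a = 0 \<or> b = 0")
    case True
    hence "U = (\<lambda>_. 0) \<or> V = (\<lambda>_. 0)" using Ua Vb by (metis le_zero_eq ext)
    thus ?thesis unfolding int by auto
  next
    case False
    have "a \<noteq> \<top>" "b \<noteq> \<top>"
      using \<open>a * b \<le> 1\<close> False by (auto simp: ennreal_top_mult ennreal_mult_top top_unique)
    then obtain a' b' where a': "a = ennreal a'" "a' > 0" and b': "b = ennreal b'" "b' > 0"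
      using False by (cases a; cases b) (auto simp: less_le)
    define U' V' where "U' x = enn2real (U x) / a'" and "V' x = enn2real (V x) / b'" for x
    have UU: "U x = ennreal (a' * U' x)" and VV: "V x = ennreal (b' * V' x)" for x
      using Ua[of x] Vb[of x] a' b' by (auto simp: U'_def V'_def ennreal_enn2real_if top_unique)
    have nn: "0 \<le> U' x" "0 \<le> V' x" for x using a' b' by (auto simp: U'_def V'_def)
    have [measurable]: "U' \<in> borel_measurable borel" "V' \<in> borel_measurable borel"
      by (simp_all add: U'_def[abs_def] V'_def[abs_def])
    \<comment> \<open>Dividing the bound on \<open>U x * V y\<close> by \<open>a' * b'\<close> then
      gives the square of the density over \<open>c\<close>, the form required by the
      Prekopa-Leindler bound.\<close>
    define c where "c = sqrt (a' * b')"
    have c: "0 < c" "c\<^sup>2 = a' * b'" using a' b' by (auto simp: c_def)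
    define P Q where "P = (\<integral>\<^sup>+x. ennreal (U' x) \<partial>lborel)" and "Q = (\<integral>\<^sup>+x. ennreal (V' x) \<partial>lborel)"
    have "P + Q \<le> ennreal (2 / c)"
      unfolding P_def Q_def
    proof (rule prekopa_leindler_std_normal)
      show "U' x \<le> 1" "V' x \<le> 1" for x
        using Ua[of x] Vb[of x] a' b' nn[of x] unfolding UU VV
        by (auto simp: mult_le_cancel_left1 mult_nonneg_nonneg ennreal_le_iff)
      show "\<exists>x. s < U' x" if "s < 1" for s
      proof (cases "s < 0")
        case False
        have "ennreal (a' * s) < a" using that a' False by (simp add: ennreal_less_iff)
        then obtain x where "ennreal (a' * s) < U x" unfolding a_def less_SUP_iff by auto
        thus ?thesis using a' False unfolding UU by (auto simp: ennreal_less_iff)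
      qed (use nn in \<open>auto intro: less_le_trans\<close>)
      show "\<exists>x. s < V' x" if "s < 1" for s
      proof (cases "s < 0")
        case False
        have "ennreal (b' * s) < b" using that b' False by (simp add: ennreal_less_iff)
        then obtain x where "ennreal (b' * s) < V x" unfolding b_def less_SUP_iff by auto
        thus ?thesis using b' False unfolding VV by (auto simp: ennreal_less_iff)
      qed (use nn in \<open>auto intro: less_le_trans\<close>)
      show "U' x * V' y \<le> (std_normal_density ((x + y) / 2) / c)\<^sup>2" for x y
      proof -
        have "ennreal (a' * U' x * (b' * V' y)) \<le> ennreal ((std_normal_density ((x + y) / 2))\<^sup>2)"
          using UV[of x y] a' b' nn unfolding UU VV by (simp add: ennreal_mult)
        hence "a' * U' x * (b' * V' y) \<le> (std_normal_density ((x + y) / 2))\<^sup>2"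
          by (simp add: ennreal_le_iff)
        thus ?thesis using a' b' by (simp add: power_divide c(2) field_simps)
      qed
    qed (use nn c in auto)
    then obtain p q where pq: "P = ennreal p" "Q = ennreal q" "0 \<le> p" "0 \<le> q" "p + q \<le> 2 / c"
      using c by (cases P; cases Q) (auto simp flip: ennreal_plus simp: top_unique ennreal_le_iff)
    have "a' * p * (b' * q) = c\<^sup>2 * (p * q)" by (simp add: c)
    also have "\<dots> \<le> c\<^sup>2 * ((p + q) / 2)\<^sup>2"
      using sum_squares_bound[of p q] by (intro mult_left_mono) (auto simp: power2_eq_square field_simps)
    also have "\<dots> \<le> c\<^sup>2 * (1 / c)\<^sup>2"
      using pq by (intro mult_left_mono power_mono) auto
    also have "\<dots> = 1" using c(1) by (simp add: power_divide)
    finally have "a' * p * (b' * q) \<le> 1" .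
    hence "ennreal (a' * p) * ennreal (b' * q) \<le> 1"
      using a' b' pq by (simp add: ennreal_mult[symmetric])
    moreover have "(\<integral>\<^sup>+x. U x \<partial>lborel) = ennreal (a' * p)" "(\<integral>\<^sup>+x. V x \<partial>lborel) = ennreal (b' * q)"
      unfolding UU VV using a' b' nn pq
      by (simp_all add: ennreal_mult nn_integral_cmult P_def Q_def)
    ultimately show ?thesis unfolding int by simp
  qed
qed

interpretation std_normal: prob_space std_normal
  by (rule prob_space_std_normal)

interpretation std_normal_product: product_sigma_finite "\<lambda>_::'i. std_normal" ..

abbreviation std_gaussian :: "'i set \<Rightarrow> ('i \<Rightarrow> real) measure" where
  "std_gaussian I \<equiv> PiM I (\<lambda>_. std_normal)"

lemma prob_space_std_gaussian: "prob_space (std_gaussian I)"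
  by (rule prob_space_PiM) (rule prob_space_std_normal)

text \<open>Induction over coordinates: because the squared distance is a sum over coordinates,
  integrating coordinate \<open>i\<close> out of \<open>u\<close> and \<open>v\<close> gives
  functions of the other coordinates that satisfy the same hypothesis.\<close>

theorem gaussian_property_tau:
  fixes u v :: "('i \<Rightarrow> real) \<Rightarrow> ennreal"
  assumes "finite I"
    and "u \<in> borel_measurable (std_gaussian I)" "v \<in> borel_measurable (std_gaussian I)"
    and "\<And>x y. x \<in> (\<Pi>\<^sub>E i\<in>I. UNIV) \<Longrightarrow> y \<in> (\<Pi>\<^sub>E i\<in>I. UNIV) \<Longrightarrow>
      u x * v y \<le> ennreal (exp ((\<Sum>i\<in>I. (x i - y i)\<^sup>2) / 4))"
  shows "(\<integral>\<^sup>+x. u x \<partial>std_gaussian I) * (\<integral>\<^sup>+x. v x \<partial>std_gaussian I) \<le> 1"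
  using assms
proof (induction I arbitrary: u v rule: finite_induct)
  case empty
  then show ?case
    by (simp add: std_normal_product.nn_integral_empty)
next
  case (insert i I)
  note [measurable] = insert.prems(1,2)
  note uv = insert.prems(3)
  define U V where "U x = (\<integral>\<^sup>+s. u (x(i := s)) \<partial>std_normal)" and "V x = (\<integral>\<^sup>+s. v (x(i := s)) \<partial>std_normal)" for x
  have upd: "(\<lambda>s. w (x(i := s))) \<in> borel_measurable borel"
    if [measurable]: "w \<in> borel_measurable (std_gaussian (insert i I))" and x: "x \<in> (\<Pi>\<^sub>E i\<in>I. UNIV)"
    for w :: "('i \<Rightarrow> real) \<Rightarrow> ennreal" and x
  proof -
    have [measurable]: "x \<in> space (std_gaussian I)" using x by (simp add: space_PiM)
    have "(\<lambda>s. w (x(i := s))) \<in> borel_measurable std_normal"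
      by measurable
    thus ?thesis by simp
  qed
  have "(\<integral>\<^sup>+x. U x \<partial>std_gaussian I) * (\<integral>\<^sup>+x. V x \<partial>std_gaussian I) \<le> 1"
  proof (rule insert.IH)
    show "U \<in> borel_measurable (std_gaussian I)" "V \<in> borel_measurable (std_gaussian I)"
      unfolding U_def V_def by measurable
    fix x y :: "'i \<Rightarrow> real" assume x: "x \<in> (\<Pi>\<^sub>E i\<in>I. UNIV)" and y: "y \<in> (\<Pi>\<^sub>E i\<in>I. UNIV)"
    \<comment> \<open>\<open>S\<close> is the share of the other coordinates; attaching
      \<open>exp (- S)\<close> to \<open>v\<close> leaves exactly the one-dimensional hypothesis in
      \<open>s\<close> and \<open>t\<close>.\<close>
    define S where "S = (\<Sum>i\<in>I. (x i - y i)\<^sup>2) / 4"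
    have "(\<integral>\<^sup>+s. u (x(i := s)) \<partial>std_normal) * (\<integral>\<^sup>+s. ennreal (exp (- S)) * v (y(i := s)) \<partial>std_normal) \<le> 1"
    proof (rule gaussian_property_tau_real)
      fix s t :: real
      have *: "(\<Sum>j\<in>insert i I. ((x(i := s)) j - (y(i := t)) j)\<^sup>2) / 4 = S + (s - t)\<^sup>2 / 4"
      proof -
        have "(\<Sum>j\<in>I. ((x(i := s)) j - (y(i := t)) j)\<^sup>2) = (\<Sum>j\<in>I. (x j - y j)\<^sup>2)"
          using insert.hyps by (intro sum.cong) auto
        thus ?thesis using insert.hyps by (simp add: S_def add_divide_distrib)
      qed
      have "u (x(i := s)) * (ennreal (exp (- S)) * v (y(i := t))) = ennreal (exp (- S)) * (u (x(i := s)) * v (y(i := t)))"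
        by (simp add: mult_ac)
      also have "\<dots> \<le> ennreal (exp (- S)) * ennreal (exp (S + (s - t)\<^sup>2 / 4))"
        using x y by (intro mult_left_mono order_trans[OF uv[of "x(i := s)" "y(i := t)"]])
          (simp_all only: *, auto simp: PiE_def extensional_def)
      also have "\<dots> = ennreal (exp ((s - t)\<^sup>2 / 4))"
        by (simp add: ennreal_mult[symmetric] exp_add[symmetric])
      finally show "u (x(i := s)) * (ennreal (exp (- S)) * v (y(i := t))) \<le> ennreal (exp ((s - t)\<^sup>2 / 4))" .
    next
      show "(\<lambda>s. u (x(i := s))) \<in> borel_measurable borel"
        by (rule upd[OF insert.prems(1) x])
      show "(\<lambda>s. ennreal (exp (- S)) * v (y(i := s))) \<in> borel_measurable borel"
        by (intro borel_measurable_times_ennreal borel_measurable_const upd[OF insert.prems(2) y])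
    qed
    moreover have "(\<integral>\<^sup>+s. ennreal (exp (- S)) * v (y(i := s)) \<partial>std_normal) = ennreal (exp (- S)) * V y"
      unfolding V_def by (rule nn_integral_cmult) (simp only: measurable_cong_sets[OF sets_std_normal refl] upd[OF insert.prems(2) y])
    ultimately have *: "ennreal (exp (- S)) * (U x * V y) \<le> 1"
      by (simp add: U_def mult.left_commute)
    have "U x * V y = ennreal (exp S) * (ennreal (exp (- S)) * (U x * V y))"
      by (simp add: mult.assoc[symmetric] ennreal_mult[symmetric] exp_add[symmetric])
    also have "\<dots> \<le> ennreal (exp S) * 1" by (intro mult_left_mono *) auto
    finally show "U x * V y \<le> ennreal (exp ((\<Sum>i\<in>I. (x i - y i)\<^sup>2) / 4))" by (simp add: S_def)
  qed
  moreover have "(\<integral>\<^sup>+x. u x \<partial>std_gaussian (insert i I)) = (\<integral>\<^sup>+x. U x \<partial>std_gaussian I)"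
    "(\<integral>\<^sup>+x. v x \<partial>std_gaussian (insert i I)) = (\<integral>\<^sup>+x. V x \<partial>std_gaussian I)"
    unfolding U_def V_def using insert.prems(1,2)
    by (auto intro: std_normal_product.product_nn_integral_insert[OF insert.hyps(1,2)])
  ultimately show ?case by simp
qed

section \<open>Gaussian moments and dimension-free concentration of Lipschitz functions\<close>

lemma integrable_std_normal: "integrable std_normal (\<lambda>x. x)" "integrable std_normal (\<lambda>x. x\<^sup>2)"
  and integral_std_normal_square: "(\<integral>x. x\<^sup>2 \<partial>std_normal) = 1"
proof -
  show "integrable std_normal (\<lambda>x. x)" "integrable std_normal (\<lambda>x. x\<^sup>2)"
    unfolding std_normal_def using integrable_std_normal_moment[of 1] integrable_std_normal_moment[of 2]
    by (auto simp: integrable_density)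
  show "(\<integral>x. x\<^sup>2 \<partial>std_normal) = 1"
    unfolding std_normal_def using integral_std_normal_moment_even[of 1]
    by (simp add: integral_density)
qed

lemma distr_std_gaussian_component:
  assumes "i \<in> I"
  shows "distr (std_gaussian I) borel (\<lambda>x. x i) = std_normal"
proof -
  have "distr (std_gaussian I) borel (\<lambda>x. x i) = distr (std_gaussian I) std_normal (\<lambda>x. x i)"
    by (rule distr_cong) auto
  thus ?thesis using distr_PiM_component[of I "\<lambda>_. std_normal" i] assms prob_space_std_normal by simp
qed

lemma measurable_std_gaussian_component[measurable (raw)]:
  "i \<in> I \<Longrightarrow> (\<lambda>x. x i) \<in> borel_measurable (std_gaussian I)"
  using measurable_component_singleton[of i I "\<lambda>_. std_normal"] by (simp cong: measurable_cong_sets)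

lemma integrable_std_gaussian_component:
  assumes "i \<in> I"
  shows "integrable (std_gaussian I) (\<lambda>x. x i)" "integrable (std_gaussian I) (\<lambda>x. (x i)\<^sup>2)"
    "(\<integral>x. (x i)\<^sup>2 \<partial>std_gaussian I) = 1"
proof -
  note D = distr_std_gaussian_component[OF assms]
  note m = measurable_std_gaussian_component[OF assms]
  show "integrable (std_gaussian I) (\<lambda>x. x i)"
    by (rule integrable_distr[OF m]) (unfold D, rule integrable_std_normal)
  show "integrable (std_gaussian I) (\<lambda>x. (x i)\<^sup>2)"
    by (rule integrable_distr[OF m]) (unfold D, rule integrable_std_normal)
  have "(\<integral>y. y\<^sup>2 \<partial>distr (std_gaussian I) borel (\<lambda>x. x i)) = (\<integral>x. (x i)\<^sup>2 \<partial>std_gaussian I)"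
    by (rule integral_distr[OF m]) simp
  thus "(\<integral>x. (x i)\<^sup>2 \<partial>std_gaussian I) = 1"
    unfolding D integral_std_normal_square by simp
qed

lemma borel_measurable_L2_set:
  assumes "finite I" and "\<And>i. i \<in> I \<Longrightarrow> f i \<in> borel_measurable M"
  shows "(\<lambda>x. L2_set (\<lambda>i. f i x) I) \<in> borel_measurable M"
  unfolding L2_set_def using assms by measurable

lemma integrable_std_gaussian_L2_set:
  assumes "finite I"
  shows "integrable (std_gaussian I) (\<lambda>x. L2_set x I)" "integrable (std_gaussian I) (\<lambda>x. (L2_set x I)\<^sup>2)"
    and integral_std_gaussian_L2_set_square: "(\<integral>x. (L2_set x I)\<^sup>2 \<partial>std_gaussian I) = real (card I)"
proof -
  have [measurable]: "(\<lambda>x. L2_set x I) \<in> borel_measurable (std_gaussian I)"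
    by (rule borel_measurable_L2_set[OF assms]) (rule measurable_std_gaussian_component)
  have "integrable (std_gaussian I) (\<lambda>x. \<Sum>i\<in>I. \<bar>x i\<bar>)"
    by (intro Bochner_Integration.integrable_sum integrable_abs integrable_std_gaussian_component)
  thus "integrable (std_gaussian I) (\<lambda>x. L2_set x I)"
    by (rule Bochner_Integration.integrable_bound) (simp_all add: L2_set_nonneg L2_set_le_sum_abs sum_nonneg)
  have sq: "(L2_set x I)\<^sup>2 = (\<Sum>i\<in>I. (x i)\<^sup>2)" for x :: "'a \<Rightarrow> real"
    by (simp add: L2_set_def sum_nonneg)
  show "integrable (std_gaussian I) (\<lambda>x. (L2_set x I)\<^sup>2)"
    unfolding sq by (intro Bochner_Integration.integrable_sum integrable_std_gaussian_component)
  have "(\<integral>x. (\<Sum>i\<in>I. (x i)\<^sup>2) \<partial>std_gaussian I) = (\<Sum>i\<in>I. \<integral>x. (x i)\<^sup>2 \<partial>std_gaussian I)"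
    by (rule Bochner_Integration.integral_sum) (rule integrable_std_gaussian_component)
  thus "(\<integral>x. (L2_set x I)\<^sup>2 \<partial>std_gaussian I) = real (card I)"
    unfolding sq by (simp add: integrable_std_gaussian_component)
qed

text \<open>Jensen's inequality from the tangent line of \<open>exp\<close> at the mean; in
  \<open>ennreal\<close> an infinite exponential moment makes it trivial.\<close>

lemma (in prob_space) exp_expectation_le:
  assumes "integrable M f"
  shows "ennreal (exp (expectation f)) \<le> (\<integral>\<^sup>+x. ennreal (exp (f x)) \<partial>M)"
proof (cases "(\<integral>\<^sup>+x. ennreal (exp (f x)) \<partial>M) = \<top>")
  case False
  let ?m = "expectation f"
  have [measurable]: "f \<in> borel_measurable M" using assms by auto
  have int: "integrable M (\<lambda>x. exp (f x))"
    using False by (intro integrableI_nonneg) (auto simp: less_top)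
  have "exp ?m * (1 + (f x - ?m)) \<le> exp (f x)" for x
  proof -
    have "exp ?m * (1 + (f x - ?m)) \<le> exp ?m * exp (f x - ?m)"
      by (intro mult_left_mono exp_ge_add_one_self) auto
    thus ?thesis by (simp add: exp_add[symmetric])
  qed
  hence "(\<integral>x. exp ?m * (1 + (f x - ?m)) \<partial>M) \<le> (\<integral>x. exp (f x) \<partial>M)"
    using assms int by (intro integral_mono) auto
  also have "(\<integral>x. exp ?m * (1 + (f x - ?m)) \<partial>M) = exp ?m"
    using assms by (simp add: prob_space)
  finally show ?thesis using int by (simp add: nn_integral_eq_integral ennreal_leI)
qed simp

text \<open>Comparison with the value at the origin gives linear growth, and the Gaussian norm is
  integrable. The origin \<open>?z\<close> is a restricted function so that it belongs to the
  extensional model of Euclidean space.\<close>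

lemma gaussian_lipschitz_integrable:
  assumes "finite I" and f: "f \<in> borel_measurable (std_gaussian I)"
    and lip: "\<And>x y. x \<in> (\<Pi>\<^sub>E i\<in>I. UNIV) \<Longrightarrow> y \<in> (\<Pi>\<^sub>E i\<in>I. UNIV) \<Longrightarrow>
      \<bar>f x - f y\<bar> \<le> K * L2_set (\<lambda>i. x i - y i) I"
  shows "integrable (std_gaussian I) f"
proof -
  interpret prob_space "std_gaussian I" by (rule prob_space_std_gaussian)
  let ?z = "\<lambda>i\<in>I. 0 :: real"
  have bd: "\<bar>f x\<bar> \<le> \<bar>f ?z\<bar> + K * L2_set x I" if "x \<in> space (std_gaussian I)" for x
  proof -
    have "L2_set (\<lambda>i. x i - ?z i) I = L2_set x I" by (rule L2_set_cong) auto
    thus ?thesis using lip[of x ?z] that by (auto simp: space_PiM)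
  qed
  have "integrable (std_gaussian I) (\<lambda>x. \<bar>f ?z\<bar> + K * L2_set x I)"
    using integrable_std_gaussian_L2_set[OF assms(1)] by auto
  thus ?thesis
    using f
  proof (rule Bochner_Integration.integrable_bound, intro AE_I2)
    show "norm (f x) \<le> norm (\<bar>f ?z\<bar> + K * L2_set x I)" if "x \<in> space (std_gaussian I)" for x
      using bd[OF that] unfolding real_norm_def by linarith
  qed
qed

text \<open>Property tau for \<open>exp f\<close> and \<open>exp (- f - 1)\<close>. The shift 1 is
  the maximum of \<open>d - d^2/4\<close>, attained at \<open>d = 2\<close>, so the Lipschitz bound
  gives the hypothesis. Jensen bounds the second integral below by \<open>exp (- m - 1)\<close>,
  which leaves \<open>exp 1\<close> for the centered moment.\<close>

lemma gaussian_lipschitz_exp_moment: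
  assumes "finite I" and f[measurable]: "f \<in> borel_measurable (std_gaussian I)"
    and lip: "\<And>x y. x \<in> (\<Pi>\<^sub>E i\<in>I. UNIV) \<Longrightarrow> y \<in> (\<Pi>\<^sub>E i\<in>I. UNIV) \<Longrightarrow>
      \<bar>f x - f y\<bar> \<le> L2_set (\<lambda>i. x i - y i) I"
  defines "m \<equiv> \<integral>x. f x \<partial>std_gaussian I"
  shows "(\<integral>\<^sup>+x. ennreal (exp (f x - m)) \<partial>std_gaussian I) \<le> ennreal (exp 1)"
proof -
  interpret prob_space "std_gaussian I" by (rule prob_space_std_gaussian)
  have int: "integrable (std_gaussian I) f"
    using gaussian_lipschitz_integrable[of I f 1] assms by simp
  have "(\<integral>\<^sup>+x. ennreal (exp (f x)) \<partial>std_gaussian I) * (\<integral>\<^sup>+x. ennreal (exp (- f x - 1)) \<partial>std_gaussian I) \<le> 1"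
  proof (rule gaussian_property_tau)
    fix x y :: "'a \<Rightarrow> real" assume xy: "x \<in> (\<Pi>\<^sub>E i\<in>I. UNIV)" "y \<in> (\<Pi>\<^sub>E i\<in>I. UNIV)"
    define d where "d = L2_set (\<lambda>i. x i - y i) I"
    have d: "d\<^sup>2 = (\<Sum>i\<in>I. (x i - y i)\<^sup>2)" by (simp add: d_def L2_set_def sum_nonneg)
    have "f x - f y - 1 \<le> d - 1" using lip[OF xy] by (simp add: d_def)
    also have "d - 1 \<le> d\<^sup>2 / 4" using zero_le_power2[of "d / 2 - 1"] by (simp add: power2_eq_square algebra_simps)
    finally have "exp (f x - f y - 1) \<le> exp (d\<^sup>2 / 4)" by simp
    thus "ennreal (exp (f x)) * ennreal (exp (- f y - 1)) \<le> ennreal (exp ((\<Sum>i\<in>I. (x i - y i)\<^sup>2) / 4))"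
      by (simp add: ennreal_mult[symmetric] exp_add[symmetric] d add_diff_eq)
  qed (use assms in auto)
  hence *: "(\<integral>\<^sup>+x. ennreal (exp (f x)) \<partial>std_gaussian I) * ennreal (exp (- m - 1)) \<le> 1"
  proof (rule order_trans[rotated], intro mult_left_mono)
    show "ennreal (exp (- m - 1)) \<le> (\<integral>\<^sup>+x. ennreal (exp (- f x - 1)) \<partial>std_gaussian I)"
      using exp_expectation_le[of "\<lambda>x. - f x - 1"] int by (simp add: m_def prob_space)
  qed auto
  have "(\<integral>\<^sup>+x. ennreal (exp (f x - m)) \<partial>std_gaussian I)
      = ennreal (exp 1) * ((\<integral>\<^sup>+x. ennreal (exp (f x)) \<partial>std_gaussian I) * ennreal (exp (- m - 1)))"
  proof -
    have "ennreal (exp (f x - m)) = ennreal (exp 1) * (ennreal (exp (f x)) * ennreal (exp (- m - 1)))" for x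
      by (simp add: ennreal_mult[symmetric] exp_add[symmetric])
    thus ?thesis by (simp only:) (simp add: nn_integral_cmult nn_integral_multc)
  qed
  also have "\<dots> \<le> ennreal (exp 1) * 1" by (intro mult_left_mono *) auto
  finally show ?thesis by simp
qed

text \<open>Both \<open>g = f / K\<close> and its negative are 1-Lipschitz, and
  \<open>z^2 \<le> 2 * (exp z + exp (- z))\<close> turns their centered exponential moments into a
  variance of at most \<open>4 * exp 1\<close>. The constant 12 comes from
  \<open>exp 1 \<le> 3\<close>.\<close>

theorem gaussian_lipschitz_variance:
  assumes "finite I" "K > 0" and f[measurable]: "f \<in> borel_measurable (std_gaussian I)"
    and lip: "\<And>x y. x \<in> (\<Pi>\<^sub>E i\<in>I. UNIV) \<Longrightarrow> y \<in> (\<Pi>\<^sub>E i\<in>I. UNIV) \<Longrightarrow>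
      \<bar>f x - f y\<bar> \<le> K * L2_set (\<lambda>i. x i - y i) I"
  defines "m \<equiv> \<integral>x. f x \<partial>std_gaussian I"
  shows "(\<integral>\<^sup>+x. ennreal ((f x - m)\<^sup>2) \<partial>std_gaussian I) \<le> ennreal (12 * K\<^sup>2)"
proof -
  interpret prob_space "std_gaussian I" by (rule prob_space_std_gaussian)
  define g where "g x = f x / K" for x
  define k where "k = m / K"
  have [measurable]: "g \<in> borel_measurable (std_gaussian I)" by (simp add: g_def[abs_def])
  have gl: "\<bar>g x - g y\<bar> \<le> L2_set (\<lambda>i. x i - y i) I"
    if "x \<in> (\<Pi>\<^sub>E i\<in>I. UNIV)" "y \<in> (\<Pi>\<^sub>E i\<in>I. UNIV)" for x y
    using lip[OF that] \<open>K > 0\<close> by (simp add: g_def diff_divide_distrib[symmetric] pos_divide_le_eq mult.commute)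
  have k: "(\<integral>x. g x \<partial>std_gaussian I) = k" "(\<integral>x. - g x \<partial>std_gaussian I) = - k"
    by (simp_all add: g_def k_def m_def)
  have e: "(\<integral>\<^sup>+x. ennreal (exp (g x - k)) \<partial>std_gaussian I) \<le> ennreal (exp 1)"
    "(\<integral>\<^sup>+x. ennreal (exp (- g x + k)) \<partial>std_gaussian I) \<le> ennreal (exp 1)"
    using gaussian_lipschitz_exp_moment[of I g] gaussian_lipschitz_exp_moment[of I "\<lambda>x. - g x"] gl \<open>finite I\<close>
    unfolding k by (auto simp: abs_minus_commute)
  have "z\<^sup>2 \<le> 2 * (exp z + exp (- z))" for z :: real
    using exp_lower_Taylor_quadratic[of z] exp_lower_Taylor_quadratic[of "- z"] exp_gt_zero[of z] exp_gt_zero[of "-z"]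
    by (cases "z \<ge> 0") (auto simp del: exp_gt_zero)
  note exp_sq = this
  have sq: "(f x - m)\<^sup>2 \<le> 2 * K\<^sup>2 * (exp (g x - k) + exp (- g x + k))" for x
  proof -
    have "f x - m = K * (g x - k)" using \<open>K > 0\<close>
      by (simp add: g_def k_def right_diff_distrib)
    hence "(f x - m)\<^sup>2 = K\<^sup>2 * (g x - k)\<^sup>2" by (simp add: power_mult_distrib)
    also have "\<dots> \<le> K\<^sup>2 * (2 * (exp (g x - k) + exp (- (g x - k))))"
      by (intro mult_left_mono exp_sq) auto
    finally show ?thesis by (simp add: algebra_simps)
  qed
  have "(\<integral>\<^sup>+x. ennreal ((f x - m)\<^sup>2) \<partial>std_gaussian I)
      \<le> (\<integral>\<^sup>+x. ennreal (2 * K\<^sup>2) * (ennreal (exp (g x - k)) + ennreal (exp (- g x + k))) \<partial>std_gaussian I)"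
    using sq by (intro nn_integral_mono) (simp add: ennreal_mult[symmetric] ennreal_plus[symmetric] ennreal_leI del: ennreal_plus)
  also have "\<dots> = ennreal (2 * K\<^sup>2) * ((\<integral>\<^sup>+x. ennreal (exp (g x - k)) \<partial>std_gaussian I) + (\<integral>\<^sup>+x. ennreal (exp (- g x + k)) \<partial>std_gaussian I))"
    by (simp add: nn_integral_cmult nn_integral_add)
  also have "\<dots> \<le> ennreal (2 * K\<^sup>2) * (ennreal (exp 1) + ennreal (exp 1))"
    by (intro mult_left_mono add_mono e) auto
  also have "\<dots> = ennreal (4 * K\<^sup>2 * exp 1)"
    by (simp add: ennreal_mult[symmetric] ennreal_plus[symmetric] del: ennreal_plus)
  also have "\<dots> \<le> ennreal (12 * K\<^sup>2)"
    using exp_le by (intro ennreal_leI) (auto intro: mult_right_mono)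
  finally show ?thesis .
qed

subsection \<open>The Cauchy measure as a Gaussian scale mixture\<close>

text \<open>Substituting \<open>w = a / (2 * t^2)\<close> gives the Gamma integral at
  \<open>p / 2\<close>. The value \<open>a = 1\<close> normalizes \<open>nu\<close>;
  \<open>a = 1 + |x|^2\<close> produces the Cauchy density.\<close>

lemma nn_integral_powr_exp_inverse_square:
  fixes a p :: real
  assumes a: "0 < a" and p: "0 < p"
  shows "(\<integral>\<^sup>+t. ennreal (1 / t powr (p + 1) * exp (- (a / (2 * t\<^sup>2)))) * indicator {0<..} t \<partial>lborel)
    = ennreal ((2 / a) powr (p / 2) * Gamma (p / 2) / 2)"
proof -
  define f where "f w = w powr (p / 2 - 1) / exp w" for w :: real
  define g where "g t = a / (2 * t\<^sup>2)" for t :: real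
  define g' where "g' t = - a / t ^ 3" for t :: real
  have "(f has_integral Gamma (p / 2)) {0..}"
    using Gamma_integral_real[of "p / 2"] p by (simp add: f_def[abs_def])
  \<comment> \<open>The substitution is a bijection of the open half-line, so the endpoint 0 is
    removed.\<close>
  hence f: "(f has_integral Gamma (p / 2)) {0<..}"
    by (rule has_integral_spike_set_eq[THEN iffD1, rotated -1]) (auto intro: negligible_subset[of "{0}"])
  have "f absolutely_integrable_on {0<..}"
    using f by (intro nonnegative_absolutely_integrable_1) (auto simp: f_def has_integral_integrable)
  moreover have "g ` {0<..} = {0<..}"
  proof (intro equalityI subsetI)
    fix w :: real assume "w \<in> {0<..}"
    hence "g (sqrt (a / (2 * w))) = w" "sqrt (a / (2 * w)) \<in> {0<..}" using a by (auto simp: g_def)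
    thus "w \<in> g ` {0<..}" by (metis imageI)
  qed (use a in \<open>auto simp: g_def\<close>)
  moreover have "integral {0<..} f = Gamma (p / 2)" using f by (rule integral_unique)
  moreover have der: "(g has_field_derivative g' t) (at t within {0<..})" if "t \<in> {0<..}" for t
    unfolding g_def g'_def using that
    by (auto intro!: derivative_eq_intros simp: field_simps power2_eq_square power3_eq_cube)
  moreover have inj: "inj_on g {0<..}" using a by (auto simp: g_def inj_on_def)
  ultimately have "(\<lambda>t. \<bar>g' t\<bar> * f (g t)) absolutely_integrable_on {0<..} \<and>
      integral {0<..} (\<lambda>t. \<bar>g' t\<bar> * f (g t)) = Gamma (p / 2)"
    by (subst has_absolute_integral_change_of_variables_1'[OF _ der inj]) auto
  hence "((\<lambda>t. \<bar>g' t\<bar> * f (g t)) has_integral Gamma (p / 2)) {0<..}"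
    using absolutely_integrable_on_def integrable_integral by metis
  \<comment> \<open>The factor cancels the constants coming from the Jacobian \<open>a / t^3\<close>
    and from the power of \<open>a / 2\<close> in \<open>f (g t)\<close>.\<close>
  hence "((\<lambda>t. (2 / a) powr (p / 2) / 2 * (\<bar>g' t\<bar> * f (g t))) has_integral (2 / a) powr (p / 2) / 2 * Gamma (p / 2)) {0<..}"
    by (rule has_integral_mult_right)
  moreover have "(2 / a) powr (p / 2) / 2 * (\<bar>g' t\<bar> * f (g t)) = 1 / t powr (p + 1) * exp (- (a / (2 * t\<^sup>2)))"
    if "t \<in> {0<..}" for t
  proof -
    have t: "t > 0" using that by simp
    have "g t = (a / 2) / t powr 2" using t by (simp add: g_def)
    hence "(g t) powr (p / 2 - 1) = (a / 2) powr (p / 2 - 1) / (t powr 2) powr (p / 2 - 1)"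
      using t a by (simp only: powr_divide)
    also have "(t powr 2) powr (p / 2 - 1) = t powr p / t powr 2"
      unfolding powr_powr powr_diff[symmetric] by (simp add: right_diff_distrib)
    also have "(a / 2) powr (p / 2 - 1) / (t powr p / t powr 2) = (a / 2) powr (p / 2) / (a / 2) * (t powr 2 / t powr p)"
      using a by (simp add: powr_diff)
    finally have *: "(g t) powr (p / 2 - 1) = (a / 2) powr (p / 2) / (a / 2) * (t powr 2 / t powr p)" .
    have q: "(2 / a) powr (p / 2) = 1 / (a / 2) powr (p / 2)"
      using a by (simp add: powr_divide)
    have r: "\<bar>g' t\<bar> = a / t powr 3" "t powr (p + 1) = t powr p * t" "t powr 3 = t * t powr 2"
      using t a by (auto simp: g'_def powr_add powr_realpow power3_eq_cube power2_eq_square)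
    have "(2 / a) powr (p / 2) / 2 * (\<bar>g' t\<bar> * f (g t)) =
        (1 / (a / 2) powr (p / 2)) / 2 * (a / (t * t powr 2) * ((a / 2) powr (p / 2) / (a / 2) * (t powr 2 / t powr p) / exp (g t)))"
      unfolding f_def * q r ..
    also have "\<dots> = 1 / (t powr p * t) * (1 / exp (g t))"
      using t a by simp
    finally show ?thesis unfolding r g_def exp_minus by (simp add: inverse_eq_divide)
  qed
  ultimately have "((\<lambda>t. 1 / t powr (p + 1) * exp (- (a / (2 * t\<^sup>2)))) has_integral (2 / a) powr (p / 2) / 2 * Gamma (p / 2)) {0<..}"
    by (rule has_integral_eq[rotated])
  from nn_integral_has_integral_lebesgue'[OF _ this] show ?thesis by simp
qed

lemma distr_std_normal_scale:
  assumes "0 < t"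
  shows "distr std_normal borel (\<lambda>x. t * x) = density lborel (\<lambda>x. ennreal (normal_density 0 t x))"
proof -
  have "distr std_normal lborel (\<lambda>x. x) = std_normal"
    by (rule measure_eqI) (simp_all add: emeasure_distr)
  hence "distributed std_normal lborel (\<lambda>x. x) std_normal_density"
    unfolding distributed_def by (simp add: std_normal_def)
  hence "distributed std_normal lborel (\<lambda>x. 0 + t * x) (normal_density (0 + t * 0) (\<bar>t\<bar> * 1))"
    using assms by (intro std_normal.normal_density_affine) auto
  hence "distr std_normal lborel (\<lambda>x. t * x) = density lborel (\<lambda>x. ennreal (normal_density 0 t x))"
    using assms by (simp add: distributed_def)
  moreover have "distr std_normal borel (\<lambda>x. t * x) = distr std_normal lborel (\<lambda>x. t * x)"
    by (rule distr_cong) auto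
  ultimately show ?thesis by simp
qed

lemma PiM_density_lborel:
  assumes "finite I" and [measurable]: "f \<in> borel_measurable borel" and "prob_space (density lborel f)"
  shows "PiM I (\<lambda>_. density lborel f) = density (PiM I (\<lambda>_. lborel)) (\<lambda>x. \<Prod>i\<in>I. f (x i :: real))"
proof -
  interpret L: product_sigma_finite "\<lambda>_::'a. lborel :: real measure" ..
  interpret P: prob_space "density lborel f" by fact
  interpret D: product_sigma_finite "\<lambda>_::'a. density lborel f" ..
  show ?thesis
  proof (rule sym, rule D.PiM_eqI)
    show "sets (density (PiM I (\<lambda>_. lborel)) (\<lambda>x. \<Prod>i\<in>I. f (x i))) = sets (PiM I (\<lambda>_. density lborel f))"
      by (simp cong: sets_PiM_cong)
    fix A assume A: "\<And>i. i \<in> I \<Longrightarrow> A i \<in> sets (density lborel f)"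
    have [measurable]: "Pi\<^sub>E I A \<in> sets (PiM I (\<lambda>_. lborel))"
      using A assms(1) by (intro sets_PiM_I_finite) auto
    have [measurable]: "(\<lambda>x. \<Prod>i\<in>I. f (x i)) \<in> borel_measurable (PiM I (\<lambda>_. lborel))"
      by measurable
    have "emeasure (density (PiM I (\<lambda>_. lborel)) (\<lambda>x. \<Prod>i\<in>I. f (x i))) (Pi\<^sub>E I A)
        = (\<integral>\<^sup>+x. (\<Prod>i\<in>I. f (x i)) * indicator (Pi\<^sub>E I A) x \<partial>PiM I (\<lambda>_. lborel))"
      by (simp add: emeasure_density)
    also have "\<dots> = (\<integral>\<^sup>+x. (\<Prod>i\<in>I. f (x i) * indicator (A i) (x i)) \<partial>PiM I (\<lambda>_. lborel))"
    proof (rule nn_integral_cong)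
      fix x assume x: "x \<in> space (PiM I (\<lambda>_. lborel :: real measure))"
      have "(\<Prod>i\<in>I. indicator (A i) (x i)) = (indicator (Pi\<^sub>E I A) x :: ennreal)"
      proof (cases "x \<in> Pi\<^sub>E I A")
        case False
        then obtain i where "i \<in> I" "x i \<notin> A i" using x by (auto simp: space_PiM PiE_def)
        hence "(\<Prod>i\<in>I. indicator (A i) (x i)) = (0 :: ennreal)"
          using assms(1) by (intro prod_zero) (auto intro!: bexI[of _ i])
        thus ?thesis using False by simp
      qed (auto simp: PiE_def Pi_def)
      thus "(\<Prod>i\<in>I. f (x i)) * indicator (Pi\<^sub>E I A) x = (\<Prod>i\<in>I. f (x i) * indicator (A i) (x i))"
        by (simp add: prod.distrib)
    qed
    also have "\<dots> = (\<Prod>i\<in>I. \<integral>\<^sup>+x. f x * indicator (A i) x \<partial>lborel)"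
      using assms(1) A by (intro L.product_nn_integral_prod) auto
    also have "\<dots> = (\<Prod>i\<in>I. emeasure (density lborel f) (A i))"
      using A by (intro prod.cong) (auto simp: emeasure_density)
    finally show "emeasure (density (PiM I (\<lambda>_. lborel)) (\<lambda>x. \<Prod>i\<in>I. f (x i))) (Pi\<^sub>E I A) = \<dots>" .
  qed fact
qed

lemma measurable_PiM_lborel_eq: "measurable (PiM I (\<lambda>_. lborel)) N = measurable (PiM I (\<lambda>_. borel)) N"
  by (intro measurable_cong_sets sets_PiM_cong) auto

text \<open>Scaling acts coordinatewise, so the law of the scaled vector is a product of
  one-dimensional normal laws, and its density is the product of theirs.\<close>

lemma nn_integral_std_gaussian_scale:
  fixes g :: "('i \<Rightarrow> real) \<Rightarrow> ennreal"
  assumes "finite I" "0 < t" and g: "g \<in> borel_measurable (PiM I (\<lambda>_. borel))"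
  shows "(\<integral>\<^sup>+z. g (\<lambda>i\<in>I. t * z i) \<partial>std_gaussian I)
    = (\<integral>\<^sup>+x. (\<Prod>i\<in>I. ennreal (normal_density 0 t (x i))) * g x \<partial>PiM I (\<lambda>_. lborel))"
proof -
  let ?D = "density lborel (\<lambda>x. ennreal (normal_density 0 t x))"
  have P: "prob_space ?D" using assms(2) by (intro prob_space_normal_density)
  have m: "(\<lambda>z. \<lambda>i\<in>I. t * z i) \<in> measurable (std_gaussian I) (PiM I (\<lambda>_. borel))"
    by (intro measurable_restrict) measurable
  have gL: "g \<in> borel_measurable (PiM I (\<lambda>_. lborel))"
    using g unfolding measurable_PiM_lborel_eq .
  have "(\<integral>\<^sup>+z. g (\<lambda>i\<in>I. t * z i) \<partial>std_gaussian I)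
      = (\<integral>\<^sup>+x. g x \<partial>distr (std_gaussian I) (PiM I (\<lambda>_. borel)) (\<lambda>z. \<lambda>i\<in>I. t * z i))"
    using g by (simp add: nn_integral_distr[OF m])
  also have "distr (std_gaussian I) (PiM I (\<lambda>_. borel)) (\<lambda>z. \<lambda>i\<in>I. t * z i)
      = distr (std_gaussian I) (PiM I (\<lambda>_. ?D)) (compose I (\<lambda>x. t * x))"
    by (intro distr_cong) (auto simp: compose_def intro!: sets_PiM_cong)
  also have "\<dots> = PiM I (\<lambda>_. distr std_normal ?D (\<lambda>x. t * x))"
    using assms(1) P by (intro distr_PiM_finite_prob_space' prob_space_std_normal) (auto simp: std_normal_def)
  also have "distr std_normal ?D (\<lambda>x. t * x) = distr std_normal borel (\<lambda>x. t * x)"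
    by (intro distr_cong) auto
  also have "\<dots> = ?D" by (rule distr_std_normal_scale[OF assms(2)])
  also have "PiM I (\<lambda>_. ?D) = density (PiM I (\<lambda>_. lborel)) (\<lambda>x. \<Prod>i\<in>I. ennreal (normal_density 0 t (x i)))"
    using assms P by (intro PiM_density_lborel) auto
  also have "(\<integral>\<^sup>+x. g x \<partial>density (PiM I (\<lambda>_. lborel)) (\<lambda>x. \<Prod>i\<in>I. ennreal (normal_density 0 t (x i))))
      = (\<integral>\<^sup>+x. (\<Prod>i\<in>I. ennreal (normal_density 0 t (x i))) * g x \<partial>PiM I (\<lambda>_. lborel))"
    by (rule nn_integral_density[OF _ gL]) measurable
  finally show ?thesis .
qed

definition nu_density :: "real \<Rightarrow> real \<Rightarrow> real" where
  "nu_density \<beta> t = 2 powr (1 - \<beta> / 2) / Gamma (\<beta> / 2) * (1 / t powr (\<beta> + 1)) * exp (- (1 / (2 * t\<^sup>2)))"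

lemma borel_measurable_nu_density[measurable]: "nu_density \<beta> \<in> borel_measurable borel"
  unfolding nu_density_def[abs_def] by measurable

lemma nu_density_pos: "0 < \<beta> \<Longrightarrow> 0 < t \<Longrightarrow> 0 < nu_density \<beta> t"
  by (simp add: nu_density_def Gamma_real_pos)

lemma nu_density_nonneg: "0 < \<beta> \<Longrightarrow> 0 \<le> nu_density \<beta> t"
  by (simp add: nu_density_def Gamma_real_pos less_imp_le)

lemma sets_nu: "sets (nu \<beta>) = sets (restrict_space borel {0..})"
  and space_nu: "space (nu \<beta>) = {0..}"
  by (simp_all add: nu_def space_restrict_space cong: sets_restrict_space_cong)

text \<open>The endpoint 0 is a Lebesgue null set. Dropping it leaves \<open>t > 0\<close>, where
  the Gaussian scaled by \<open>t\<close> has a density.\<close>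

lemma nn_integral_nu:
  assumes [measurable]: "h \<in> borel_measurable borel"
  shows "(\<integral>\<^sup>+t. h t \<partial>nu \<beta>) = (\<integral>\<^sup>+t. ennreal (nu_density \<beta> t) * h t * indicator {0<..} t \<partial>lborel)"
proof -
  have "nu \<beta> = density (restrict_space lborel {0..}) (\<lambda>t. ennreal (nu_density \<beta> t))"
    by (simp add: nu_def nu_density_def)
  moreover have "(\<lambda>t. ennreal (nu_density \<beta> t)) \<in> borel_measurable (restrict_space lborel {0..})"
    "h \<in> borel_measurable (restrict_space lborel {0..})"
    by (auto intro!: measurable_restrict_space1)
  ultimately have "(\<integral>\<^sup>+t. h t \<partial>nu \<beta>) = (\<integral>\<^sup>+t. ennreal (nu_density \<beta> t) * h t \<partial>restrict_space lborel {0..})"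
    by (simp add: nn_integral_density)
  also have "\<dots> = (\<integral>\<^sup>+t. ennreal (nu_density \<beta> t) * h t * indicator {0..} t \<partial>lborel)"
    by (subst nn_integral_restrict_space) auto
  also have "\<dots> = (\<integral>\<^sup>+t. ennreal (nu_density \<beta> t) * h t * indicator {0<..} t \<partial>lborel)"
    using AE_lborel_singleton[of 0]
    by (intro nn_integral_cong_AE) (auto elim!: eventually_mono simp: indicator_def)
  finally show ?thesis .
qed

lemma prod_normal_density:
  assumes t: "0 < t"
  shows "(\<Prod>i<n. normal_density 0 t (x i))
    = 1 / ((2 * pi) powr (real n / 2) * t powr real n) * exp (- ((L2_set x {..<n})\<^sup>2 / (2 * t\<^sup>2)))"
proof -
  have "(\<Prod>i<n. normal_density 0 t (x i)) = (1 / sqrt (2 * pi * t\<^sup>2)) ^ n * exp (\<Sum>i<n. - (x i)\<^sup>2 / (2 * t\<^sup>2))"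
    by (simp only: normal_density_def prod.distrib exp_sum[OF finite_lessThan] prod_constant card_lessThan diff_0_right)
  also have "(\<Sum>i<n. - (x i)\<^sup>2 / (2 * t\<^sup>2)) = - ((L2_set x {..<n})\<^sup>2 / (2 * t\<^sup>2))"
    by (simp add: L2_set_def sum_nonneg sum_divide_distrib sum_negf)
  also have "(1 / sqrt (2 * pi * t\<^sup>2)) ^ n = 1 / ((2 * pi) powr (real n / 2) * t powr real n)"
  proof -
    have "(2 * pi) powr (real n / 2) = ((2 * pi) powr (1 / 2)) powr real n"
      by (simp add: powr_powr)
    hence "(2 * pi) powr (real n / 2) = sqrt (2 * pi) ^ n"
      by (simp add: powr_half_sqrt powr_realpow)
    thus ?thesis using t by (simp add: real_sqrt_mult power_mult_distrib powr_realpow power_one_over)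
  qed
  finally show ?thesis .
qed

text \<open>For fixed \<open>x\<close> the exponents \<open>1 / (2 * t^2)\<close> and
  \<open>|x|^2 / (2 * t^2)\<close> add up, which is where \<open>1 + |x|^2\<close> comes from, and
  the powers of \<open>t\<close> combine to the exponent \<open>n + \<beta> + 1\<close>. The
  integral over \<open>t\<close> is then of Gamma type with \<open>p = n + \<beta>\<close>.\<close>

lemma normal_product_density_mixture:
  fixes x :: "nat \<Rightarrow> real"
  assumes "0 < \<beta>"
  shows "(\<integral>\<^sup>+t. (\<Prod>i<n. ennreal (normal_density 0 t (x i))) \<partial>nu \<beta>)
    = ennreal (Gamma ((real n + \<beta>) / 2) / (pi powr (real n / 2) * Gamma (\<beta> / 2))
              * (1 / (1 + (L2_set x {..<n})\<^sup>2) powr ((real n + \<beta>) / 2)))"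
proof -
  define a where "a = 1 + (L2_set x {..<n})\<^sup>2"
  define p where "p = real n + \<beta>"
  have a: "0 < a" by (auto simp: a_def intro: add_pos_nonneg)
  have p: "0 < p" using assms by (simp add: p_def)
  define C where "C = 2 powr (1 - \<beta> / 2) / Gamma (\<beta> / 2) / (2 * pi) powr (real n / 2)"
  have C: "0 \<le> C" using assms by (simp add: C_def Gamma_real_pos less_imp_le)
  have [measurable]: "(\<lambda>t. \<Prod>i<n. ennreal (normal_density 0 t (x i))) \<in> borel_measurable borel"
    unfolding normal_density_def by measurable
  have dens: "nu_density \<beta> t * (\<Prod>i<n. normal_density 0 t (x i)) = C * (1 / t powr (p + 1) * exp (- (a / (2 * t\<^sup>2))))"
    if t: "0 < t" for t
  proof -
    have e: "exp (- (1 / (2 * t\<^sup>2))) * exp (- ((L2_set x {..<n})\<^sup>2 / (2 * t\<^sup>2))) = exp (- (a / (2 * t\<^sup>2)))"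
      unfolding exp_add[symmetric] a_def by (simp add: add_divide_distrib)
    have q: "t powr (\<beta> + 1) * t powr real n = t powr (p + 1)"
      using t by (simp add: powr_add p_def)
    have "nu_density \<beta> t * (\<Prod>i<n. normal_density 0 t (x i)) = C * (1 / (t powr (\<beta> + 1) * t powr real n) *
        (exp (- (1 / (2 * t\<^sup>2))) * exp (- ((L2_set x {..<n})\<^sup>2 / (2 * t\<^sup>2)))))"
      by (simp add: prod_normal_density[OF t] nu_density_def C_def mult.assoc)
    thus ?thesis unfolding e q .
  qed
  have "(\<integral>\<^sup>+t. (\<Prod>i<n. ennreal (normal_density 0 t (x i))) \<partial>nu \<beta>)
      = (\<integral>\<^sup>+t. ennreal (nu_density \<beta> t) * (\<Prod>i<n. ennreal (normal_density 0 t (x i))) * indicator {0<..} t \<partial>lborel)"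
    by (rule nn_integral_nu) measurable
  also have "\<dots> = (\<integral>\<^sup>+t. ennreal C * (ennreal (1 / t powr (p + 1) * exp (- (a / (2 * t\<^sup>2)))) * indicator {0<..} t) \<partial>lborel)"
  proof (intro nn_integral_cong)
    fix t :: real
    show "ennreal (nu_density \<beta> t) * (\<Prod>i<n. ennreal (normal_density 0 t (x i))) * indicator {0<..} t
        = ennreal C * (ennreal (1 / t powr (p + 1) * exp (- (a / (2 * t\<^sup>2)))) * indicator {0<..} t)"
    proof (cases "0 < t")
      case True
      have "ennreal (nu_density \<beta> t) * (\<Prod>i<n. ennreal (normal_density 0 t (x i)))
          = ennreal (nu_density \<beta> t * (\<Prod>i<n. normal_density 0 t (x i)))"
        using nu_density_nonneg[OF assms] by (simp add: prod_ennreal ennreal_mult prod_nonneg)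
      also have "\<dots> = ennreal C * ennreal (1 / t powr (p + 1) * exp (- (a / (2 * t\<^sup>2))))"
        unfolding dens[OF True] using C by (rule ennreal_mult') 
      finally show ?thesis using True by simp
    qed simp
  qed
  also have "\<dots> = ennreal C * ennreal ((2 / a) powr (p / 2) * Gamma (p / 2) / 2)"
    by (subst nn_integral_cmult) (measurable, simp only: nn_integral_powr_exp_inverse_square[OF a p])
  also have "\<dots> = ennreal (C * ((2 / a) powr (p / 2) * Gamma (p / 2) / 2))"
    using C by (rule ennreal_mult'[symmetric])
  also have "C * ((2 / a) powr (p / 2) * Gamma (p / 2) / 2)
      = Gamma (p / 2) / (pi powr (real n / 2) * Gamma (\<beta> / 2)) * (1 / a powr (p / 2))"
  proof -
    have "(2 / a) powr (p / 2) = 2 powr (real n / 2) * 2 powr (\<beta> / 2) / a powr (p / 2)"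
      using a by (simp add: powr_divide powr_add[symmetric] add_divide_distrib p_def)
    moreover have "2 powr (1 - \<beta> / 2) = 2 / 2 powr (\<beta> / 2)"
      "(2 * pi) powr (real n / 2) = 2 powr (real n / 2) * pi powr (real n / 2)"
      by (simp_all add: powr_diff powr_mult)
    ultimately show ?thesis by (simp add: C_def)
  qed
  finally show ?thesis unfolding a_def p_def .
qed

lemma sets_cauchy_measure: "sets (cauchy_measure \<beta> n) = sets (PiM {..<n} (\<lambda>_. borel))"
  by (simp add: cauchy_measure_def cong: sets_PiM_cong)

text \<open>Write the Cauchy density as a mixture over \<open>t\<close>, exchange the integrals, and
  at each fixed \<open>t\<close> read the normal density as the law of a scaled Gaussian. This is
  the representation by T Z in integral form.\<close>

theorem nn_integral_cauchy_measure:
  assumes "0 < \<beta>" and g: "g \<in> borel_measurable (PiM {..<n} (\<lambda>_. borel))"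
  shows "(\<integral>\<^sup>+x. g x \<partial>cauchy_measure \<beta> n)
    = (\<integral>\<^sup>+t. (\<integral>\<^sup>+z. g (\<lambda>i\<in>{..<n}. t * z i) \<partial>std_gaussian {..<n}) \<partial>nu \<beta>)"
proof -
  interpret L: product_sigma_finite "\<lambda>_::nat. lborel :: real measure" ..
  interpret F: finite_product_sigma_finite "\<lambda>_::nat. lborel :: real measure" "{..<n}" by standard simp
  interpret N: prob_space "std_gaussian {..<n}" by (rule prob_space_std_gaussian)
  interpret P: pair_sigma_finite "PiM {..<n} (\<lambda>_. lborel :: real measure)" "lborel :: real measure" ..
  let ?L = "PiM {..<n} (\<lambda>_. lborel :: real measure)"
  have gL[measurable]: "g \<in> borel_measurable ?L"
    using g unfolding measurable_PiM_lborel_eq .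
  define p where "p t x = (\<Prod>i<n. ennreal (normal_density 0 t (x i)))" for t :: real and x :: "nat \<Rightarrow> real"
  have p[measurable]: "(\<lambda>(x, t). p t x) \<in> borel_measurable (?L \<Otimes>\<^sub>M lborel)"
    unfolding p_def normal_density_def by measurable
  have [measurable]: "(\<lambda>t. p t x) \<in> borel_measurable borel" for x
    unfolding p_def normal_density_def by measurable
  have [measurable]: "(\<lambda>x. p t x) \<in> borel_measurable ?L" for t
    unfolding p_def normal_density_def by measurable
  have [measurable]: "(\<lambda>t. \<integral>\<^sup>+z. g (\<lambda>i\<in>{..<n}. t * z i) \<partial>std_gaussian {..<n}) \<in> borel_measurable borel"
  proof -
    have "(\<lambda>q. \<lambda>i\<in>{..<n}. fst q * snd q i) \<in> measurable (borel \<Otimes>\<^sub>M std_gaussian {..<n}) (PiM {..<n} (\<lambda>_. borel))"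
      by (intro measurable_restrict) measurable
    from measurable_compose[OF this g] show ?thesis
      by (intro N.borel_measurable_nn_integral) (simp add: case_prod_unfold)
  qed
  have "(\<integral>\<^sup>+x. g x \<partial>cauchy_measure \<beta> n) = (\<integral>\<^sup>+x. (\<integral>\<^sup>+t. p t x \<partial>nu \<beta>) * g x \<partial>?L)"
  proof -
    have [measurable]: "(\<lambda>x. (L2_set x {..<n})\<^sup>2) \<in> borel_measurable ?L"
      unfolding L2_set_def by measurable
    show ?thesis unfolding p_def normal_product_density_mixture[OF assms(1)] cauchy_measure_def
      by (subst nn_integral_density) auto
  qed
  also have "\<dots> = (\<integral>\<^sup>+x. (\<integral>\<^sup>+t. ennreal (nu_density \<beta> t) * p t x * indicator {0<..} t * g x \<partial>lborel) \<partial>?L)"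
    by (subst nn_integral_nu) (auto simp: nn_integral_multc)
  also have "\<dots> = (\<integral>\<^sup>+t. (\<integral>\<^sup>+x. ennreal (nu_density \<beta> t) * p t x * indicator {0<..} t * g x \<partial>?L) \<partial>lborel)"
    by (rule P.Fubini'[symmetric]) measurable
  also have "\<dots> = (\<integral>\<^sup>+t. ennreal (nu_density \<beta> t) * (\<integral>\<^sup>+z. g (\<lambda>i\<in>{..<n}. t * z i) \<partial>std_gaussian {..<n}) * indicator {0<..} t \<partial>lborel)"
  proof (intro nn_integral_cong)
    fix t :: real
    show "(\<integral>\<^sup>+x. ennreal (nu_density \<beta> t) * p t x * indicator {0<..} t * g x \<partial>?L)
        = ennreal (nu_density \<beta> t) * (\<integral>\<^sup>+z. g (\<lambda>i\<in>{..<n}. t * z i) \<partial>std_gaussian {..<n}) * indicator {0<..} t"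
    proof (cases "0 < t")
      case True
      have "(\<integral>\<^sup>+x. ennreal (nu_density \<beta> t) * p t x * indicator {0<..} t * g x \<partial>?L)
          = ennreal (nu_density \<beta> t) * (\<integral>\<^sup>+x. p t x * g x \<partial>?L)"
        using True by (simp add: mult.assoc nn_integral_cmult)
      also have "(\<integral>\<^sup>+x. p t x * g x \<partial>?L) = (\<integral>\<^sup>+z. g (\<lambda>i\<in>{..<n}. t * z i) \<partial>std_gaussian {..<n})"
        unfolding p_def by (rule nn_integral_std_gaussian_scale[OF _ True g, symmetric]) simp
      finally show ?thesis using True by simp
    qed simp
  qed
  also have "\<dots> = (\<integral>\<^sup>+t. (\<integral>\<^sup>+z. g (\<lambda>i\<in>{..<n}. t * z i) \<partial>std_gaussian {..<n}) \<partial>nu \<beta>)"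
    by (rule nn_integral_nu[symmetric]) measurable
  finally show ?thesis .
qed

text \<open>Dimension 0 of the mixture identity: the empty product is 1, and the right-hand side is
  a quotient of equal Gamma values.\<close>

lemma prob_space_nu:
  assumes "0 < \<beta>"
  shows "prob_space (nu \<beta>)"
proof
  have "Gamma (\<beta> / 2) \<noteq> 0" using Gamma_real_pos[of "\<beta> / 2"] assms by (metis half_gt_zero less_irrefl)
  hence "(\<integral>\<^sup>+t. 1 \<partial>nu \<beta>) = 1"
    using normal_product_density_mixture[OF assms, where n=0] by simp
  thus "emeasure (nu \<beta>) (space (nu \<beta>)) = 1" by simp
qed

subsection \<open>Observable diameter of the half-line\<close>

text \<open>The interval starting at \<open>Inf S\<close> works. With it, partial diameters on the
  line become statements about masses of closed intervals.\<close>

lemma bounded_spread_subset_interval: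
  fixes S :: "real set"
  assumes "\<And>x y. x \<in> S \<Longrightarrow> y \<in> S \<Longrightarrow> \<bar>x - y\<bar> \<le> L"
  shows "\<exists>c. S \<subseteq> {c..c + L}"
proof (cases "S = {}")
  case False
  have "bdd_below S"
  proof -
    obtain y where "y \<in> S" using False by auto
    thus ?thesis using assms by (intro bdd_belowI[of _ "y - L"]) (smt (verit))
  qed
  moreover have "x - L \<le> Inf S" if "x \<in> S" for x
    using False assms[OF that] by (intro cInf_greatest) (auto simp: abs_le_iff algebra_simps)
  ultimately have "S \<subseteq> {Inf S..Inf S + L}"
    using cInf_lower by force
  thus ?thesis by blast
qed simp

lemma partial_diam_line_le:
  assumes "sets M = sets borel" "0 \<le> L" "\<alpha> \<le> measure M {c..c + L}"
  shows "partial_diam (mm_line M) \<alpha> \<le> ennreal L"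
proof -
  have "partial_diam (mm_line M) \<alpha> \<le> ediam (\<lambda>x y. \<bar>x - y\<bar>) {c..c + L}"
    unfolding partial_diam_def mm_line_def using assms
    by (intro INF_lower2[of "{c..c + L}"]) simp_all
  also have "\<dots> \<le> ennreal L"
    unfolding ediam_def by (intro SUP_least ennreal_leI) auto
  finally show ?thesis .
qed

text \<open>The infimum over sets need not be attained, hence the strict hypothesis: it provides a
  Borel set of diameter below \<open>L\<close>, which is then enclosed in an interval of length
  \<open>L\<close>.\<close>

lemma partial_diam_line_less:
  assumes "prob_space M" "sets M = sets borel" "0 < \<alpha>" "partial_diam (mm_line M) \<alpha> < ennreal L"
  shows "0 \<le> L \<and> (\<exists>c. \<alpha> \<le> measure M {c..c + L})"
proof -
  interpret prob_space M by fact
  obtain A where A: "A \<in> sets M" "\<alpha> \<le> measure M A" and d: "ediam (\<lambda>x y. \<bar>x - y\<bar>) A < ennreal L"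
    using assms(4) unfolding partial_diam_def mm_line_def by (auto simp: INF_less_iff)
  have L: "0 \<le> L" using d by (metis ennreal_neg less_imp_le linorder_not_le not_less_zero)
  have "\<bar>x - y\<bar> \<le> L" if "x \<in> A" "y \<in> A" for x y
  proof -
    have "ennreal \<bar>x - y\<bar> \<le> ediam (\<lambda>x y. \<bar>x - y\<bar>) A"
      unfolding ediam_def using that by (intro SUP_upper2[of "(x, y)"]) auto
    thus ?thesis using d L by (metis ennreal_le_iff le_less_trans less_imp_le)
  qed
  then obtain c where "A \<subseteq> {c..c + L}" using bounded_spread_subset_interval[of A L] by blast
  hence "measure M A \<le> measure M {c..c + L}"
    using assms(2) by (intro finite_measure_mono) auto
  thus ?thesis using A L by (meson order_trans)
qed

text \<open>The law of T on the whole line, so that intervals reaching below 0 have a mass. It is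
  the image of \<open>nu\<close> under the identity, the extremal 1-Lipschitz function on the
  half-line.\<close>

definition nu_line :: "real \<Rightarrow> real measure" where
  "nu_line \<beta> = distr (nu \<beta>) borel (\<lambda>t. t)"

lemma sets_nu_line[simp, measurable_cong]: "sets (nu_line \<beta>) = sets borel"
  and space_nu_line[simp]: "space (nu_line \<beta>) = UNIV"
  by (simp_all add: nu_line_def)

lemma borel_measurable_nu:
  "f \<in> borel_measurable (restrict_space borel {0..}) \<Longrightarrow> f \<in> borel_measurable (nu \<beta>)"
  by (subst measurable_cong_sets[OF sets_nu refl])

lemma measurable_id_nu: "(\<lambda>t. t) \<in> borel_measurable (nu \<beta>)"
  by (intro borel_measurable_nu measurable_restrict_space1) simp

lemma prob_space_nu_line: "0 < \<beta> \<Longrightarrow> prob_space (nu_line \<beta>)"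
  unfolding nu_line_def by (intro prob_space.prob_space_distr prob_space_nu measurable_id_nu)

lemma nn_integral_nu_line:
  "h \<in> borel_measurable borel \<Longrightarrow> (\<integral>\<^sup>+t. h t \<partial>nu_line \<beta>) = (\<integral>\<^sup>+t. h t \<partial>nu \<beta>)"
  unfolding nu_line_def by (rule nn_integral_distr[OF measurable_id_nu]) simp

lemma measure_nu_line:
  "A \<in> sets borel \<Longrightarrow> measure (nu_line \<beta>) A = measure (nu \<beta>) (A \<inter> {0..})"
  unfolding nu_line_def by (subst measure_distr[OF measurable_id_nu]) (auto simp: space_nu)

text \<open>The density is positive on \<open>{max a 0<..<b}\<close>, which has positive length.
  Hence a closed interval with nonnegative right end gains mass when it is prolonged to the
  right.\<close>

lemma nu_line_Ioo_pos:
  assumes "0 < \<beta>" "a < b" "0 < b"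
  shows "0 < measure (nu_line \<beta>) {a<..<b}"
proof -
  interpret prob_space "nu_line \<beta>" by (rule prob_space_nu_line) fact
  have "emeasure (nu_line \<beta>) {a<..<b} = (\<integral>\<^sup>+t. indicator {a<..<b} t \<partial>nu_line \<beta>)" by simp
  also have "\<dots> = (\<integral>\<^sup>+t. ennreal (nu_density \<beta> t) * indicator {a<..<b} t * indicator {0<..} t \<partial>lborel)"
    by (subst nn_integral_nu_line) (auto intro: nn_integral_nu)
  also have "\<dots> \<noteq> 0"
  proof
    assume "(\<integral>\<^sup>+t. ennreal (nu_density \<beta> t) * indicator {a<..<b} t * indicator {0<..} t \<partial>lborel) = 0"
    hence "AE t in lborel. ennreal (nu_density \<beta> t) * indicator {a<..<b} t * indicator {0<..} t = 0"
      by (subst (asm) nn_integral_0_iff_AE) auto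
    hence "AE t in lborel. t \<notin> {max a 0<..<b}"
    proof (rule AE_mp, intro AE_I2 impI)
      fix t assume *: "ennreal (nu_density \<beta> t) * indicator {a<..<b} t * indicator {0<..} t = 0"
      show "t \<notin> {max a 0<..<b}"
        using * nu_density_pos[OF assms(1), of t] by (auto simp: indicator_def split: if_splits)
    qed
    hence "{max a 0<..<b} \<in> null_sets lborel"
      by (simp add: AE_iff_null_sets)
    thus False using assms by (auto simp: null_sets_def)
  qed
  finally show ?thesis by (simp add: emeasure_eq_measure zero_less_measure_iff)
qed

text \<open>A 1-Lipschitz function maps the part of an interval of length \<open>L\<close> in the
  half-line into an interval of length \<open>L\<close>, so no image of \<open>nu\<close> has a
  larger partial diameter than its image under the identity.\<close>

lemma obs_diam_half_line_space:
  assumes "0 < \<beta>" "\<kappa> < 1"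
  shows "obs_diam (half_line_space \<beta>) \<kappa> = partial_diam (mm_line (nu_line \<beta>)) (1 - \<kappa>)"
proof (rule antisym)
  show "partial_diam (mm_line (nu_line \<beta>)) (1 - \<kappa>) \<le> obs_diam (half_line_space \<beta>) \<kappa>"
    unfolding obs_diam_def nu_line_def half_line_space_def
    by (intro SUP_upper2[of "\<lambda>t. t"]) (auto simp: one_Lipschitz_def)
  interpret nu: prob_space "nu \<beta>" by (rule prob_space_nu) fact
  show "obs_diam (half_line_space \<beta>) \<kappa> \<le> partial_diam (mm_line (nu_line \<beta>)) (1 - \<kappa>)"
    unfolding obs_diam_def
  proof (rule SUP_least)
    fix f assume "f \<in> {f. one_Lipschitz (half_line_space \<beta>) f}"
    hence f: "\<bar>f x - f y\<bar> \<le> \<bar>x - y\<bar>" if "0 \<le> x" "0 \<le> y" for x y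
      using that by (simp add: one_Lipschitz_def half_line_space_def)
    have "1-lipschitz_on {0..} f" using f by (intro lipschitz_onI) (auto simp: dist_real_def)
    hence fm: "f \<in> borel_measurable (nu \<beta>)"
      by (intro borel_measurable_nu borel_measurable_continuous_on_restrict lipschitz_on_continuous_on)
    show "partial_diam (mm_line (distr (mm_meas (half_line_space \<beta>)) borel f)) (1 - \<kappa>)
        \<le> partial_diam (mm_line (nu_line \<beta>)) (1 - \<kappa>)" (is "?F \<le> ?N")
    proof (rule ccontr)
      assume "\<not> ?F \<le> ?N"
      then obtain l where l: "?N < l" "l < ?F" using dense by (auto simp: not_le)
      then obtain L where L: "l = ennreal L" by (cases l) auto
      obtain c where c: "1 - \<kappa> \<le> measure (nu_line \<beta>) {c..c + L}" and L0: "0 \<le> L"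
        using partial_diam_line_less[OF prob_space_nu_line[OF assms(1)], of "1 - \<kappa>" L] l assms L by auto
      have "\<bar>x - y\<bar> \<le> L" if "x \<in> f ` ({c..c + L} \<inter> {0..})" "y \<in> f ` ({c..c + L} \<inter> {0..})" for x y
        using that by (auto intro!: order_trans[OF f])
      then obtain d where "f ` ({c..c + L} \<inter> {0..}) \<subseteq> {d..d + L}"
        using bounded_spread_subset_interval by meson
      hence "{c..c + L} \<inter> {0..} \<subseteq> f -` {d..d + L} \<inter> space (nu \<beta>)"
        by (auto simp: space_nu)
      hence "measure (nu \<beta>) ({c..c + L} \<inter> {0..}) \<le> measure (nu \<beta>) (f -` {d..d + L} \<inter> space (nu \<beta>))"
        by (intro nu.finite_measure_mono measurable_sets[OF fm]) auto
      hence "1 - \<kappa> \<le> measure (distr (nu \<beta>) borel f) {d..d + L}"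
        using c by (simp add: measure_nu_line measure_distr[OF fm])
      hence "?F \<le> ennreal L"
        using L0 by (intro partial_diam_line_le) (auto simp: half_line_space_def)
      thus False using l L by simp
    qed
  qed
qed

text \<open>Continuity is used on the full type \<open>nat \<Rightarrow> real\<close>: composing
  \<open>f\<close> with restriction gives a function continuous in the product topology, whose Borel
  sets form the countable product sigma-algebra. Padding with zeros pulls measurability back to
  \<open>n\<close> coordinates.\<close>

lemma borel_measurable_PiM_lipschitz:
  fixes f :: "(nat \<Rightarrow> real) \<Rightarrow> real"
  assumes lip: "\<And>x y. x \<in> (\<Pi>\<^sub>E i\<in>{..<n}. UNIV) \<Longrightarrow> y \<in> (\<Pi>\<^sub>E i\<in>{..<n}. UNIV) \<Longrightarrow>
      \<bar>f x - f y\<bar> \<le> K * L2_set (\<lambda>i. x i - y i) {..<n}"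
  shows "f \<in> borel_measurable (PiM {..<n} (\<lambda>_. borel))"
proof -
  define F where "F x = f (restrict x {..<n})" for x
  have "continuous_on UNIV F"
    unfolding continuous_on_def
  proof
    fix x :: "nat \<Rightarrow> real"
    have "\<bar>F y - F x\<bar> \<le> K * L2_set (\<lambda>i. y i - x i) {..<n}" for y
    proof -
      have "L2_set (\<lambda>i. restrict y {..<n} i - restrict x {..<n} i) {..<n} = L2_set (\<lambda>i. y i - x i) {..<n}"
        by (rule L2_set_cong) auto
      thus ?thesis using lip[of "restrict y {..<n}" "restrict x {..<n}"] by (simp add: F_def)
    qed
    moreover have "((\<lambda>y. K * L2_set (\<lambda>i. y i - x i) {..<n}) \<longlongrightarrow> K * sqrt (\<Sum>i<n. (x i - x i)\<^sup>2)) (at x)"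
    proof -
      have "((\<lambda>y. y i) \<longlongrightarrow> x i) (at x)" for i
        by (metis continuous_on_def continuous_on_product_coordinates UNIV_I)
      thus ?thesis unfolding L2_set_def by (intro tendsto_intros)
    qed
    ultimately have "((\<lambda>y. F y - F x) \<longlongrightarrow> 0) (at x)"
      by (intro Lim_null_comparison[of "\<lambda>y. F y - F x" "\<lambda>y. K * L2_set (\<lambda>i. y i - x i) {..<n}"]) simp_all
    thus "(F \<longlongrightarrow> F x) (at x within UNIV)" by (simp add: LIM_zero_iff)
  qed
  hence "F \<in> borel_measurable borel" by (rule borel_measurable_continuous_onI)
  hence F: "F \<in> borel_measurable (PiM UNIV (\<lambda>_::nat. borel :: real measure))"
    by (simp only: measurable_cong_sets[OF sets_PiM_equal_borel refl])
  have "(\<lambda>x. \<lambda>i\<in>UNIV. if i < n then x i else 0) \<in> measurable (PiM {..<n} (\<lambda>_. borel)) (PiM UNIV (\<lambda>_::nat. borel :: real measure))"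
  proof (rule measurable_restrict)
    fix i :: nat
    show "(\<lambda>x. if i < n then x i else 0) \<in> borel_measurable (PiM {..<n} (\<lambda>_. borel :: real measure))"
      by (cases "i < n") auto
  qed
  from measurable_compose[OF this F]
  have "(\<lambda>x. F (\<lambda>i\<in>UNIV. if i < n then x i else 0)) \<in> borel_measurable (PiM {..<n} (\<lambda>_. borel))" .
  moreover have "F (\<lambda>i\<in>UNIV. if i < n then x i else 0) = f x" if "x \<in> space (PiM {..<n} (\<lambda>_. borel :: real measure))" for x
  proof -
    have "restrict (\<lambda>i\<in>UNIV. if i < n then x i else 0) {..<n} = x"
      using that by (auto simp: space_PiM PiE_def extensional_def)
    thus ?thesis by (simp only: F_def)
  qed
  ultimately show ?thesis by (subst measurable_cong[symmetric]) auto
qed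

subsection \<open>Gaussian means of Lipschitz functions\<close>

abbreviation scaled_cauchy :: "real \<Rightarrow> nat \<Rightarrow> (nat \<Rightarrow> real) mm_triple" where
  "scaled_cauchy \<beta> n \<equiv> mm_scale (1 / sqrt (real n)) (cauchy_space \<beta> n)"

text \<open>The function m of the overview. The factor 1 / sqrt n sits in the distance, hence in the
  Lipschitz constant of \<open>f\<close>, so the argument is scaled by \<open>t\<close>
  alone.\<close>

definition gaussian_mean :: "nat \<Rightarrow> ((nat \<Rightarrow> real) \<Rightarrow> real) \<Rightarrow> real \<Rightarrow> real" where
  "gaussian_mean n f t = (\<integral>z. f (\<lambda>i\<in>{..<n}. t * z i) \<partial>std_gaussian {..<n})"

lemma one_Lipschitz_scaled_cauchy:
  "one_Lipschitz (scaled_cauchy \<beta> n) f \<longleftrightarrow>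
    (\<forall>x\<in>\<Pi>\<^sub>E i\<in>{..<n}. UNIV. \<forall>y\<in>\<Pi>\<^sub>E i\<in>{..<n}. UNIV.
      \<bar>f x - f y\<bar> \<le> 1 / sqrt (real n) * L2_set (\<lambda>i. x i - y i) {..<n})"
  by (simp add: one_Lipschitz_def mm_scale_def cauchy_space_def)

lemma borel_measurable_one_Lipschitz_scaled_cauchy:
  assumes "one_Lipschitz (scaled_cauchy \<beta> n) f"
  shows "f \<in> borel_measurable (PiM {..<n} (\<lambda>_. borel))"
  using assms unfolding one_Lipschitz_scaled_cauchy
  by (intro borel_measurable_PiM_lipschitz[where K="1 / sqrt (real n)"]) blast

lemma measurable_scale_std_gaussian:
  "(\<lambda>z. \<lambda>i\<in>I. t * z i) \<in> measurable (std_gaussian I) (PiM I (\<lambda>_. borel))"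
  by (intro measurable_restrict) measurable

lemma emeasure_cauchy_measure:
  assumes "0 < \<beta>" "f \<in> borel_measurable (PiM {..<n} (\<lambda>_. borel))" "A \<in> sets borel"
  shows "emeasure (distr (cauchy_measure \<beta> n) borel f) A
    = (\<integral>\<^sup>+t. emeasure (std_gaussian {..<n}) {z \<in> space (std_gaussian {..<n}). f (\<lambda>i\<in>{..<n}. t * z i) \<in> A} \<partial>nu \<beta>)"
proof -
  have f: "f \<in> borel_measurable (cauchy_measure \<beta> n)"
    using assms(2) by (simp only: measurable_cong_sets[OF sets_cauchy_measure refl])
  have ind: "(\<lambda>x. indicator A (f x) :: ennreal) \<in> borel_measurable (PiM {..<n} (\<lambda>_. borel))"
    using measurable_compose[OF assms(2) borel_measurable_indicator[OF assms(3)]] .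
  have "emeasure (distr (cauchy_measure \<beta> n) borel f) A = (\<integral>\<^sup>+y. indicator A y \<partial>distr (cauchy_measure \<beta> n) borel f)"
    using assms(3) by simp
  also have "\<dots> = (\<integral>\<^sup>+x. indicator A (f x) \<partial>cauchy_measure \<beta> n)"
    using assms(3) by (intro nn_integral_distr[OF f]) simp
  also have "\<dots> = (\<integral>\<^sup>+t. (\<integral>\<^sup>+z. indicator A (f (\<lambda>i\<in>{..<n}. t * z i)) \<partial>std_gaussian {..<n}) \<partial>nu \<beta>)"
    by (rule nn_integral_cauchy_measure[OF assms(1) ind])
  also have "\<dots> = (\<integral>\<^sup>+t. emeasure (std_gaussian {..<n}) {z \<in> space (std_gaussian {..<n}). f (\<lambda>i\<in>{..<n}. t * z i) \<in> A} \<partial>nu \<beta>)"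
  proof (intro nn_integral_cong)
    fix t
    let ?B = "{z \<in> space (std_gaussian {..<n}). f (\<lambda>i\<in>{..<n}. t * z i) \<in> A}"
    have "?B \<in> sets (std_gaussian {..<n})"
      using measurable_sets[OF measurable_compose[OF measurable_scale_std_gaussian assms(2)] assms(3)]
      by (simp add: vimage_def Int_def conj_commute)
    hence "emeasure (std_gaussian {..<n}) ?B = (\<integral>\<^sup>+z. indicator ?B z \<partial>std_gaussian {..<n})"
      by simp
    also have "\<dots> = (\<integral>\<^sup>+z. indicator A (f (\<lambda>i\<in>{..<n}. t * z i)) \<partial>std_gaussian {..<n})"
      by (intro nn_integral_cong) (simp add: indicator_def)
    finally show "(\<integral>\<^sup>+z. indicator A (f (\<lambda>i\<in>{..<n}. t * z i)) \<partial>std_gaussian {..<n}) = emeasure (std_gaussian {..<n}) ?B" ..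
  qed
  finally show ?thesis .
qed

lemma prob_space_cauchy_measure:
  assumes "0 < \<beta>"
  shows "prob_space (cauchy_measure \<beta> n)"
proof
  have "(\<integral>\<^sup>+x. 1 \<partial>cauchy_measure \<beta> n) = (\<integral>\<^sup>+t. (\<integral>\<^sup>+z. 1 \<partial>std_gaussian {..<n}) \<partial>nu \<beta>)"
    using assms by (intro nn_integral_cauchy_measure) simp_all
  also have "\<dots> = 1"
    using prob_space.emeasure_space_1[OF prob_space_std_gaussian, of "{..<n}"]
      prob_space.emeasure_space_1[OF prob_space_nu[OF assms]] by simp
  finally show "emeasure (cauchy_measure \<beta> n) (space (cauchy_measure \<beta> n)) = 1" by simp
qed

lemma L2_set_mult: "L2_set (\<lambda>i. t * x i) I = \<bar>t\<bar> * L2_set x I"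
  unfolding L2_set_def by (simp add: power_mult_distrib sum_distrib_left[symmetric] real_sqrt_mult)

lemma L2_set_restrict_mult_diff:
  "L2_set (\<lambda>i. (\<lambda>i\<in>I. s * x i) i - (\<lambda>i\<in>I. t * y i) i) I = L2_set (\<lambda>i. s * x i - t * y i) I"
  by (rule L2_set_cong) auto

text \<open>The variance of the norm is nonnegative and its second moment is \<open>n\<close>. As
  there is no error term, the Gaussian means are exactly 1-Lipschitz in \<open>t\<close>, not just
  asymptotically.\<close>

lemma expectation_L2_set_le:
  assumes "0 < n"
  shows "(\<integral>z. L2_set z {..<n} \<partial>std_gaussian {..<n}) \<le> sqrt (real n)"
proof -
  interpret prob_space "std_gaussian {..<n}" by (rule prob_space_std_gaussian)
  note int = integrable_std_gaussian_L2_set[of "{..<n}"]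
  have "0 \<le> variance (\<lambda>z. L2_set z {..<n})" by (rule variance_positive)
  also have "\<dots> = real n - (expectation (\<lambda>z. L2_set z {..<n}))\<^sup>2"
    using int by (simp add: variance_eq integral_std_gaussian_L2_set_square)
  finally show ?thesis by (intro real_le_rsqrt) simp
qed

context
  fixes n :: nat and f :: "(nat \<Rightarrow> real) \<Rightarrow> real"
  assumes n: "0 < n"
    and lip: "\<And>x y. x \<in> (\<Pi>\<^sub>E i\<in>{..<n}. UNIV) \<Longrightarrow> y \<in> (\<Pi>\<^sub>E i\<in>{..<n}. UNIV) \<Longrightarrow>
      \<bar>f x - f y\<bar> \<le> 1 / sqrt (real n) * L2_set (\<lambda>i. x i - y i) {..<n}"
begin

lemma scale_lipschitz:
  assumes "\<bar>t\<bar> \<le> R"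
  shows "\<bar>f (\<lambda>i\<in>{..<n}. t * x i) - f (\<lambda>i\<in>{..<n}. t * y i)\<bar> \<le> R / sqrt (real n) * L2_set (\<lambda>i. x i - y i) {..<n}"
proof -
  have "\<bar>f (\<lambda>i\<in>{..<n}. t * x i) - f (\<lambda>i\<in>{..<n}. t * y i)\<bar>
      \<le> 1 / sqrt (real n) * L2_set (\<lambda>i. t * x i - t * y i) {..<n}"
    by (subst L2_set_restrict_mult_diff[symmetric], rule lip) auto
  also have "\<dots> = 1 / sqrt (real n) * (\<bar>t\<bar> * L2_set (\<lambda>i. x i - y i) {..<n})"
    unfolding right_diff_distrib[symmetric] L2_set_mult ..
  also have "\<dots> \<le> 1 / sqrt (real n) * (R * L2_set (\<lambda>i. x i - y i) {..<n})"
    using assms by (intro mult_left_mono mult_right_mono) (auto simp: L2_set_nonneg)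
  finally show ?thesis by simp
qed

lemma scale_measurable: "(\<lambda>z. f (\<lambda>i\<in>{..<n}. t * z i)) \<in> borel_measurable (std_gaussian {..<n})"
  by (rule measurable_compose[OF measurable_scale_std_gaussian])
    (rule borel_measurable_PiM_lipschitz[OF lip])

lemma scale_integrable: "integrable (std_gaussian {..<n}) (\<lambda>z. f (\<lambda>i\<in>{..<n}. t * z i))"
  using scale_lipschitz[of t "\<bar>t\<bar>"]
  by (intro gaussian_lipschitz_integrable[where K="\<bar>t\<bar> / sqrt (real n)"] scale_measurable) auto

lemma gaussian_mean_lipschitz: "\<bar>gaussian_mean n f t - gaussian_mean n f s\<bar> \<le> \<bar>t - s\<bar>"
proof -
  interpret prob_space "std_gaussian {..<n}" by (rule prob_space_std_gaussian)
  have *: "\<bar>f (\<lambda>i\<in>{..<n}. t * z i) - f (\<lambda>i\<in>{..<n}. s * z i)\<bar> \<le> \<bar>t - s\<bar> / sqrt (real n) * L2_set z {..<n}" for z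
  proof -
    have "\<bar>f (\<lambda>i\<in>{..<n}. t * z i) - f (\<lambda>i\<in>{..<n}. s * z i)\<bar>
        \<le> 1 / sqrt (real n) * L2_set (\<lambda>i. t * z i - s * z i) {..<n}"
      by (subst L2_set_restrict_mult_diff[symmetric], rule lip) auto
    also have "\<dots> = 1 / sqrt (real n) * (\<bar>t - s\<bar> * L2_set z {..<n})"
      unfolding left_diff_distrib[symmetric] L2_set_mult ..
    finally show ?thesis by simp
  qed
  have "gaussian_mean n f t - gaussian_mean n f s
      = (\<integral>z. f (\<lambda>i\<in>{..<n}. t * z i) - f (\<lambda>i\<in>{..<n}. s * z i) \<partial>std_gaussian {..<n})"
    unfolding gaussian_mean_def by (rule Bochner_Integration.integral_diff[symmetric]) (rule scale_integrable)+
  also have "\<bar>\<dots>\<bar> \<le> (\<integral>z. \<bar>f (\<lambda>i\<in>{..<n}. t * z i) - f (\<lambda>i\<in>{..<n}. s * z i)\<bar> \<partial>std_gaussian {..<n})"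
    by (rule integral_abs_bound)
  also have "\<dots> \<le> (\<integral>z. \<bar>t - s\<bar> / sqrt (real n) * L2_set z {..<n} \<partial>std_gaussian {..<n})"
    using * integrable_std_gaussian_L2_set[of "{..<n}"] scale_integrable
    by (intro integral_mono) auto
  also have "\<dots> = \<bar>t - s\<bar> / sqrt (real n) * (\<integral>z. L2_set z {..<n} \<partial>std_gaussian {..<n})"
    by simp
  also have "\<dots> \<le> \<bar>t - s\<bar> / sqrt (real n) * sqrt (real n)"
    using n by (intro mult_left_mono expectation_L2_set_le) auto
  also have "\<dots> = \<bar>t - s\<bar>" using n by simp
  finally show ?thesis .
qed

text \<open>Chebyshev's inequality with the variance bound for the Lipschitz constant
  \<open>R / sqrt n\<close>. The common bound \<open>R\<close> makes the estimate uniform over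
  bounded \<open>t\<close> and keeps the Lipschitz constant positive at
  \<open>t = 0\<close>.\<close>

lemma gaussian_mean_concentration:
  assumes "\<bar>t\<bar> \<le> R" "0 < R" "0 < \<delta>"
  shows "emeasure (std_gaussian {..<n})
      {z \<in> space (std_gaussian {..<n}). \<delta> < \<bar>f (\<lambda>i\<in>{..<n}. t * z i) - gaussian_mean n f t\<bar>}
    \<le> ennreal (12 * R\<^sup>2 / (real n * \<delta>\<^sup>2))" (is "emeasure _ ?B \<le> _")
proof -
  note [measurable] = scale_measurable[of t]
  have B: "?B \<in> sets (std_gaussian {..<n})" by measurable
  have "ennreal (\<delta>\<^sup>2) * emeasure (std_gaussian {..<n}) ?B = (\<integral>\<^sup>+z. ennreal (\<delta>\<^sup>2) * indicator ?B z \<partial>std_gaussian {..<n})"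
    using B by (simp add: nn_integral_cmult_indicator)
  also have "\<dots> \<le> (\<integral>\<^sup>+z. ennreal ((f (\<lambda>i\<in>{..<n}. t * z i) - gaussian_mean n f t)\<^sup>2) \<partial>std_gaussian {..<n})"
  proof (intro nn_integral_mono)
    fix z assume "z \<in> space (std_gaussian {..<n})"
    show "ennreal (\<delta>\<^sup>2) * indicator ?B z \<le> ennreal ((f (\<lambda>i\<in>{..<n}. t * z i) - gaussian_mean n f t)\<^sup>2)"
    proof (cases "z \<in> ?B")
      case True
      hence "\<delta> \<le> \<bar>f (\<lambda>i\<in>{..<n}. t * z i) - gaussian_mean n f t\<bar>" by simp
      hence "\<delta>\<^sup>2 \<le> \<bar>f (\<lambda>i\<in>{..<n}. t * z i) - gaussian_mean n f t\<bar>\<^sup>2"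
        using assms(3) by (intro power_mono) auto
      thus ?thesis using True by (simp add: ennreal_leI)
    qed simp
  qed
  also have "\<dots> \<le> ennreal (12 * (R / sqrt (real n))\<^sup>2)"
    unfolding gaussian_mean_def
    using n assms scale_lipschitz[OF assms(1)]
    by (intro gaussian_lipschitz_variance scale_measurable) auto
  also have "\<dots> = ennreal (\<delta>\<^sup>2 * (12 * R\<^sup>2 / (real n * \<delta>\<^sup>2)))"
    using n assms by (simp add: power_divide)
  also have "\<dots> = ennreal (\<delta>\<^sup>2) * ennreal (12 * R\<^sup>2 / (real n * \<delta>\<^sup>2))"
    by (rule ennreal_mult') simp
  finally show ?thesis
    using assms(3) by (subst (asm) ennreal_mult_le_mult_iff) auto
qed

end

text \<open>The strict surplus of mass absorbs the factor \<open>1 - e n\<close> lost to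
  concentration. The mean maps \<open>{c..c + L}\<close> into an interval of length
  \<open>L\<close>, which is widened by \<open>\<delta>\<close> on each side for the deviation of
  \<open>f\<close> from its mean. As \<open>e\<close> does not depend on \<open>f\<close>, one
  threshold for \<open>n\<close> serves all 1-Lipschitz functions.\<close>

lemma obs_diam_cauchy_upper:
  assumes "0 < \<beta>" "0 < \<delta>" "0 \<le> L" and c: "1 - \<kappa> < measure (nu_line \<beta>) {c..c + L}"
  shows "\<forall>\<^sub>F n in sequentially. obs_diam (scaled_cauchy \<beta> n) \<kappa> \<le> ennreal (L + 2 * \<delta>)"
proof -
  interpret nl: prob_space "nu_line \<beta>" by (rule prob_space_nu_line) fact
  interpret nu: prob_space "nu \<beta>" by (rule prob_space_nu) fact
  define p where "p = measure (nu_line \<beta>) {c..c + L}"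
  \<comment> \<open>Bounds the absolute value of \<open>t\<close> on \<open>{c..c + L}\<close>; the
    added 1 makes it positive.\<close>
  define R where "R = \<bar>c\<bar> + L + 1"
  have R: "0 < R" using assms by (simp add: R_def)
  define e where "e n = 12 * R\<^sup>2 / (real n * \<delta>\<^sup>2)" for n
  have e: "e \<longlonglongrightarrow> 0"
    using lim_const_over_n[of "12 * R\<^sup>2 / \<delta>\<^sup>2"] by (simp add: e_def[abs_def] mult.commute)
  hence "(\<lambda>n. (1 - e n) * p) \<longlonglongrightarrow> (1 - 0) * p" by (intro tendsto_intros)
  hence "\<forall>\<^sub>F n in sequentially. 1 - \<kappa> < (1 - e n) * p"
    using c by (intro order_tendstoD) (auto simp: p_def)
  moreover have "\<forall>\<^sub>F n in sequentially. e n < 1"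
    using e by (intro order_tendstoD) auto
  ultimately show ?thesis
    using eventually_gt_at_top[of 0]
  proof eventually_elim
    case (elim n)
    show ?case unfolding obs_diam_def
    proof (rule SUP_least)
      fix f assume "f \<in> {f. one_Lipschitz (scaled_cauchy \<beta> n) f}"
      hence f1: "one_Lipschitz (scaled_cauchy \<beta> n) f" by simp
      note fm = borel_measurable_one_Lipschitz_scaled_cauchy[OF f1]
      have lip: "\<bar>f x - f y\<bar> \<le> 1 / sqrt (real n) * L2_set (\<lambda>i. x i - y i) {..<n}"
        if "x \<in> (\<Pi>\<^sub>E i\<in>{..<n}. UNIV)" "y \<in> (\<Pi>\<^sub>E i\<in>{..<n}. UNIV)" for x y
        using f1 that unfolding one_Lipschitz_scaled_cauchy by blast
      interpret G: prob_space "std_gaussian {..<n}" by (rule prob_space_std_gaussian)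
      let ?m = "gaussian_mean n f"
      have "\<bar>x - y\<bar> \<le> L" if xy: "x \<in> ?m ` {c..c + L}" "y \<in> ?m ` {c..c + L}" for x y
      proof -
        obtain s t where st: "x = ?m s" "y = ?m t" "s \<in> {c..c + L}" "t \<in> {c..c + L}" using xy by blast
        have "\<bar>x - y\<bar> \<le> \<bar>s - t\<bar>" unfolding st(1,2) by (rule gaussian_mean_lipschitz[OF elim(3) lip])
        also have "\<dots> \<le> L" using st(3,4) by auto
        finally show ?thesis .
      qed
      then obtain d where d: "?m ` {c..c + L} \<subseteq> {d..d + L}"
        using bounded_spread_subset_interval by meson
      define J where "J = {d - \<delta>..d + L + \<delta>}"
      have J: "J = {d - \<delta>..d - \<delta> + (L + 2 * \<delta>)}" by (simp add: J_def)
      let ?B = "\<lambda>t. {z \<in> space (std_gaussian {..<n}). f (\<lambda>i\<in>{..<n}. t * z i) \<in> J}"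
      let ?C = "\<lambda>t. {z \<in> space (std_gaussian {..<n}). \<delta> < \<bar>f (\<lambda>i\<in>{..<n}. t * z i) - ?m t\<bar>}"
      have low: "ennreal (1 - e n) \<le> emeasure (std_gaussian {..<n}) (?B t)" if t: "t \<in> {c..c + L}" for t
      proof -
        note [measurable] = scale_measurable[OF elim(3) lip, of t]
        have [measurable]: "?C t \<in> sets (std_gaussian {..<n})" "?B t \<in> sets (std_gaussian {..<n})"
          by (measurable, simp_all add: J_def)
        have "\<bar>t\<bar> \<le> R" using t by (auto simp: R_def)
        hence "emeasure (std_gaussian {..<n}) (?C t) \<le> ennreal (e n)"
          unfolding e_def by (intro gaussian_mean_concentration[OF elim(3) lip] R assms(2))
        hence "G.prob (?C t) \<le> e n"
          using R by (simp add: G.emeasure_eq_measure ennreal_le_iff e_def)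
        moreover have "space (std_gaussian {..<n}) - ?C t \<subseteq> ?B t"
          using d t by (force simp: J_def image_subset_iff abs_le_iff)
        hence "G.prob (space (std_gaussian {..<n}) - ?C t) \<le> G.prob (?B t)"
          by (intro G.finite_measure_mono) measurable
        ultimately have "1 - e n \<le> G.prob (?B t)"
          using G.prob_compl[of "?C t"] by simp
        thus ?thesis by (simp add: G.emeasure_eq_measure ennreal_leI)
      qed
      have fmc: "f \<in> borel_measurable (cauchy_measure \<beta> n)"
        using fm by (simp only: measurable_cong_sets[OF sets_cauchy_measure refl])
      interpret D: prob_space "distr (cauchy_measure \<beta> n) borel f"
        by (intro prob_space.prob_space_distr prob_space_cauchy_measure assms(1) fmc)
      have "ennreal ((1 - e n) * p) = ennreal (1 - e n) * emeasure (nu_line \<beta>) {c..c + L}"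
        using elim(2) by (simp add: nl.emeasure_eq_measure p_def ennreal_mult)
      also have "\<dots> = (\<integral>\<^sup>+t. ennreal (1 - e n) * indicator {c..c + L} t \<partial>nu_line \<beta>)"
        by (simp add: nn_integral_cmult_indicator)
      also have "\<dots> = (\<integral>\<^sup>+t. ennreal (1 - e n) * indicator {c..c + L} t \<partial>nu \<beta>)"
        by (rule nn_integral_nu_line) measurable
      \<comment> \<open>Only \<open>t\<close> in \<open>{c..c + L}\<close> is counted on the left;
        all other \<open>t\<close> contribute nonnegatively on the right.\<close>
      also have "\<dots> \<le> (\<integral>\<^sup>+t. emeasure (std_gaussian {..<n}) (?B t) \<partial>nu \<beta>)"
        using low by (intro nn_integral_mono) (auto simp: indicator_def)
      also have "\<dots> = emeasure (distr (cauchy_measure \<beta> n) borel f) J"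
        by (rule emeasure_cauchy_measure[OF assms(1) fm, symmetric]) (simp add: J_def)
      finally have "ennreal ((1 - e n) * p) \<le> emeasure (distr (cauchy_measure \<beta> n) borel f) J" .
      hence "(1 - e n) * p \<le> measure (distr (cauchy_measure \<beta> n) borel f) J"
        by (simp add: D.emeasure_eq_measure ennreal_le_iff)
      hence "1 - \<kappa> \<le> measure (distr (cauchy_measure \<beta> n) borel f) {d - \<delta>..d - \<delta> + (L + 2 * \<delta>)}"
        using elim(1) J by simp
      thus "partial_diam (mm_line (distr (mm_meas (scaled_cauchy \<beta> n)) borel f)) (1 - \<kappa>) \<le> ennreal (L + 2 * \<delta>)"
        using assms by (intro partial_diam_line_le[where c="d - \<delta>"]) (auto simp: mm_scale_def cauchy_space_def)
    qed
  qed
qed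

subsection \<open>Radial functions and compactness of intervals\<close>

lemma L2_set_reverse_triangle:
  fixes x y :: "'a \<Rightarrow> real"
  shows "\<bar>L2_set x I - L2_set y I\<bar> \<le> L2_set (\<lambda>i. x i - y i) I"
proof -
  have "L2_set x I \<le> L2_set (\<lambda>i. x i - y i) I + L2_set y I"
    using L2_set_triangle_ineq[of "\<lambda>i. x i - y i" y I] by simp
  moreover have "L2_set y I \<le> L2_set (\<lambda>i. y i - x i) I + L2_set x I"
    using L2_set_triangle_ineq[of "\<lambda>i. y i - x i" x I] by simp
  moreover have "L2_set (\<lambda>i. y i - x i) I = L2_set (\<lambda>i. x i - y i) I"
    by (simp add: L2_set_def power2_commute)
  ultimately show ?thesis by linarith
qed

text \<open>The distance to the origin in the scaled space, the test function for the lower bound: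
  on a Gaussian vector scaled by \<open>t\<close> it concentrates near \<open>t\<close>.\<close>

definition radial :: "nat \<Rightarrow> (nat \<Rightarrow> real) \<Rightarrow> real" where
  "radial n x = L2_set x {..<n} / sqrt (real n)"

lemma radial_lipschitz: "\<bar>radial n x - radial n y\<bar> \<le> 1 / sqrt (real n) * L2_set (\<lambda>i. x i - y i) {..<n}"
proof -
  have "radial n x - radial n y = (L2_set x {..<n} - L2_set y {..<n}) / sqrt (real n)"
    by (simp add: radial_def diff_divide_distrib)
  thus ?thesis
    using divide_right_mono[OF L2_set_reverse_triangle[of x "{..<n}" y], of "sqrt (real n)"] by simp
qed

lemma radial_scale: "0 \<le> t \<Longrightarrow> radial n (\<lambda>i\<in>{..<n}. t * z i) = t * radial n z"
proof -
  assume "0 \<le> t"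
  have "L2_set (\<lambda>i\<in>{..<n}. t * z i) {..<n} = L2_set (\<lambda>i. t * z i) {..<n}"
    by (rule L2_set_cong) auto
  thus ?thesis using \<open>0 \<le> t\<close> by (simp add: radial_def L2_set_mult)
qed

text \<open>By homogeneity the mean is \<open>t * q\<close> with \<open>q = E / sqrt n\<close>
  between 0 and 1. The norm has variance at most 12 in every dimension, so
  \<open>1 - q^2 \<le> 12 / n\<close>, and \<open>q^2 \<le> q\<close> passes this on to
  \<open>1 - q\<close>.\<close>

lemma gaussian_mean_radial:
  assumes n: "0 < n" and t: "0 \<le> t"
  shows "\<bar>gaussian_mean n (radial n) t - t\<bar> \<le> t * (12 / real n)"
proof -
  interpret prob_space "std_gaussian {..<n}" by (rule prob_space_std_gaussian)
  note int = integrable_std_gaussian_L2_set[of "{..<n}", OF finite_lessThan]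
  define E where "E = expectation (\<lambda>z. L2_set z {..<n})"
  define q where "q = E / sqrt (real n)"
  have E0: "0 \<le> E" unfolding E_def by (intro integral_nonneg_AE AE_I2 L2_set_nonneg)
  have mean: "gaussian_mean n (radial n) t = t * q"
    unfolding gaussian_mean_def radial_scale[OF t] unfolding radial_def q_def E_def by simp
  have "q \<le> 1" "0 \<le> q"
    using expectation_L2_set_le[OF n] n E0 by (simp_all add: q_def E_def)
  have "(\<integral>\<^sup>+z. ennreal ((L2_set z {..<n} - E)\<^sup>2) \<partial>std_gaussian {..<n}) \<le> ennreal (12 * 1\<^sup>2)"
    unfolding E_def
    by (rule gaussian_lipschitz_variance) (use int(1) L2_set_reverse_triangle in auto)
  moreover have "integrable (std_gaussian {..<n}) (\<lambda>z. (L2_set z {..<n} - E)\<^sup>2)"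
    unfolding power2_diff using int by (auto intro!: Bochner_Integration.integrable_add Bochner_Integration.integrable_diff)
  ultimately have "ennreal (variance (\<lambda>z. L2_set z {..<n})) \<le> ennreal 12"
    by (simp add: nn_integral_eq_integral E_def)
  hence "variance (\<lambda>z. L2_set z {..<n}) \<le> 12"
    by (subst (asm) ennreal_le_iff) auto
  moreover have "variance (\<lambda>z. L2_set z {..<n}) = real n - E\<^sup>2"
    using variance_eq[OF int(1,2)] integral_std_gaussian_L2_set_square[of "{..<n}"] by (simp add: E_def)
  ultimately have "real n - E\<^sup>2 \<le> 12" by simp
  hence "(real n - E\<^sup>2) / real n \<le> 12 / real n" by (intro divide_right_mono) auto
  hence "1 - 12 / real n \<le> q\<^sup>2"
    using n by (simp add: q_def power_divide diff_divide_distrib)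
  also have "q\<^sup>2 \<le> q"
    using \<open>q \<le> 1\<close> \<open>0 \<le> q\<close> by (simp add: power2_eq_square mult_left_le)
  finally have "t * (1 - q) \<le> t * (12 / real n)"
    using t by (intro mult_left_mono) auto
  moreover have "\<bar>t * q - t\<bar> = t * (1 - q)"
    using mult_nonneg_nonneg[of t "1 - q"] t \<open>q \<le> 1\<close> by (simp add: right_diff_distrib)
  ultimately show ?thesis unfolding mean by simp
qed

lemma one_Lipschitz_radial: "one_Lipschitz (scaled_cauchy \<beta> n) (radial n)"
  unfolding one_Lipschitz_scaled_cauchy by (intro ballI radial_lipschitz)

lemma prob_space_tight:
  fixes M :: "real measure"
  assumes "prob_space M" "sets M = sets borel" "0 < \<epsilon>"
  shows "\<exists>R>0. 1 - \<epsilon> < measure M {- R..R}"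
proof -
  interpret prob_space M by fact
  have "(\<lambda>n. measure M {- real n..real n}) \<longlonglongrightarrow> measure M (\<Union>n. {- real n..real n})"
  proof (rule finite_Lim_measure_incseq)
    show "range (\<lambda>n. {- real n..real n}) \<subseteq> sets M" unfolding assms(2) by (rule image_subsetI) simp
    show "incseq (\<lambda>n. {- real n..real n})" by (intro incseq_SucI) auto
  qed
  moreover have "(\<Union>n. {- real n..real n}) = space M"
  proof -
    have "x \<in> (\<Union>n. {- real n..real n})" for x
    proof -
      obtain n where "\<bar>x\<bar> \<le> real n" using real_arch_simple by blast
      hence "x \<in> {- real n..real n}" by auto
      thus ?thesis by blast
    qed
    moreover have "space M = UNIV" using sets_eq_imp_space_eq[OF assms(2)] by simp
    ultimately show ?thesis by blast
  qed
  ultimately have "(\<lambda>n. measure M {- real n..real n}) \<longlonglongrightarrow> 1"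
    by (simp add: prob_space)
  hence "\<forall>\<^sub>F n in sequentially. 1 - \<epsilon> < measure M {- real n..real n}"
    using assms(3) by (intro order_tendstoD) auto
  hence "\<forall>\<^sub>F n in sequentially. 0 < n \<and> 1 - \<epsilon> < measure M {- real n..real n}"
    using eventually_gt_at_top[of 0] by eventually_elim auto
  then obtain n where "0 < n" "1 - \<epsilon> < measure M {- real n..real n}"
    by (auto simp: eventually_sequentially)
  thus ?thesis by (intro exI[of _ "real n"]) auto
qed

text \<open>An interval of mass at least \<open>\<alpha> / 2\<close> must meet
  \<open>{- R..R}\<close>, so the left endpoints stay bounded and a subsequence converges to some
  \<open>l\<close>. Widening the limit interval by \<open>\<eta> / 2\<close> on each side makes it
  contain the intervals of the subsequence from some index on, while their mass deficits tend to
  0.\<close>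

lemma interval_measure_limit:
  fixes M :: "real measure"
  assumes "prob_space M" and sets: "sets M = sets borel" and "0 < \<alpha>" "0 < \<eta>"
    and ex: "\<And>\<epsilon>. 0 < \<epsilon> \<Longrightarrow> \<exists>c. \<alpha> - \<epsilon> \<le> measure M {c..c + L}"
  shows "\<exists>c. \<alpha> \<le> measure M {c..c + (L + \<eta>)}"
proof -
  interpret prob_space M by fact
  \<comment> \<open>Tends to 0 but never exceeds \<open>\<alpha> / 2\<close>, so every chosen
    interval keeps mass at least \<open>\<alpha> / 2\<close>.\<close>
  define \<epsilon> where "\<epsilon> k = \<alpha> / 2 / real (Suc k)" for k
  have \<epsilon>: "0 < \<epsilon> k" "\<epsilon> k \<le> \<alpha> / 2" for k
    using assms(3) by (auto simp: \<epsilon>_def field_simps)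
  obtain c where c: "\<And>k. \<alpha> - \<epsilon> k \<le> measure M {c k..c k + L}"
    using choice[of "\<lambda>k c. \<alpha> - \<epsilon> k \<le> measure M {c..c + L}"] ex[OF \<epsilon>(1)] by blast
  obtain R where R: "1 - \<alpha> / 2 < measure M {- R..R}"
    using prob_space_tight[OF assms(1) sets, of "\<alpha> / 2"] assms(3) by auto
  have "c k \<in> {- R - L..R}" for k
  proof (rule ccontr)
    assume "c k \<notin> {- R - L..R}"
    hence "{- R..R} \<inter> {c k..c k + L} = {}" by auto
    hence "measure M {- R..R} + measure M {c k..c k + L} = measure M ({- R..R} \<union> {c k..c k + L})"
      using sets by (intro finite_measure_Union[symmetric]) auto
    also have "\<dots> \<le> 1" by (rule prob_le_1)
    finally show False using R c[of k] \<epsilon>(2)[of k] by linarith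
  qed
  then obtain l r where r: "strict_mono (r :: nat \<Rightarrow> nat)" and l: "(c \<circ> r) \<longlonglongrightarrow> l"
    using compact_Icc[of "- R - L" R] unfolding compact_def by metis
  define I where "I = {l - \<eta> / 2..l - \<eta> / 2 + (L + \<eta>)}"
  have "\<forall>\<^sub>F k in sequentially. dist ((c \<circ> r) k) l < \<eta> / 2"
    using tendstoD[OF l, of "\<eta> / 2"] assms(4) by simp
  hence "\<forall>\<^sub>F k in sequentially. \<alpha> - \<epsilon> (r k) \<le> measure M I"
  proof eventually_elim
    case (elim k)
    hence "c (r k) - l < \<eta> / 2" "l - c (r k) < \<eta> / 2"
      unfolding dist_real_def o_def by linarith+
    hence "{c (r k)..c (r k) + L} \<subseteq> I" by (auto simp: I_def)
    hence "measure M {c (r k)..c (r k) + L} \<le> measure M I"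
      using sets by (intro finite_measure_mono) (auto simp: I_def)
    thus ?case using c[of "r k"] by simp
  qed
  moreover have "(\<lambda>k. \<alpha> - \<epsilon> (r k)) \<longlonglongrightarrow> \<alpha> - 0"
  proof (intro tendsto_intros)
    have "\<epsilon> \<longlonglongrightarrow> 0" unfolding \<epsilon>_def using LIMSEQ_Suc[OF lim_const_over_n[of "\<alpha> / 2"]] by simp
    thus "(\<lambda>k. \<epsilon> (r k)) \<longlonglongrightarrow> 0" using LIMSEQ_subseq_LIMSEQ[OF _ r] by (auto simp: o_def)
  qed
  ultimately have "\<alpha> - 0 \<le> measure M I"
    by (intro tendsto_upperbound) auto
  thus ?thesis unfolding I_def diff_zero by blast
qed

text \<open>Of the two shifts by \<open>\<delta>\<close>, one pays for the deviation of
  \<open>radial n\<close> from its mean and one for the deviation of the mean from \<open>t\<close>.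
  Half of the loss \<open>\<epsilon>\<close> is the tail of T beyond \<open>R\<close>, half is
  concentration. Uniformity in \<open>c\<close> and \<open>L\<close> matters because the interval is
  chosen only after \<open>n\<close>.\<close>

lemma radial_cauchy_measure_le:
  assumes "0 < \<beta>" "0 < \<epsilon>" "0 < \<delta>"
  shows "\<forall>\<^sub>F n in sequentially. \<forall>c L :: real. measure (distr (cauchy_measure \<beta> n) borel (radial n)) {c..c + L} - \<epsilon>
    \<le> measure (nu_line \<beta>) {c - 2 * \<delta>..c + L + 2 * \<delta>}"
proof -
  interpret nl: prob_space "nu_line \<beta>" by (rule prob_space_nu_line) fact
  interpret nu: prob_space "nu \<beta>" by (rule prob_space_nu) fact
  obtain R where R: "0 < R" "1 - \<epsilon> / 2 < measure (nu_line \<beta>) {- R..R}"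
    using prob_space_tight[OF nl.prob_space_axioms, of "\<epsilon> / 2"] assms(2) by auto
  define e where "e n = 12 * R\<^sup>2 / (real n * \<delta>\<^sup>2)" for n
  have "e \<longlonglongrightarrow> 0"
    using lim_const_over_n[of "12 * R\<^sup>2 / \<delta>\<^sup>2"] by (simp add: e_def[abs_def] mult.commute)
  hence "\<forall>\<^sub>F n in sequentially. e n < \<epsilon> / 2"
    using assms(2) by (intro order_tendstoD) auto
  moreover have "(\<lambda>n. R * (12 / real n)) \<longlonglongrightarrow> R * 0"
    by (intro tendsto_intros lim_const_over_n)
  hence "\<forall>\<^sub>F n in sequentially. R * (12 / real n) < \<delta>"
    using assms(3) by (intro order_tendstoD) auto
  ultimately show ?thesis
    using eventually_gt_at_top[of 0]
  proof eventually_elim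
    case (elim n)
    interpret G: prob_space "std_gaussian {..<n}" by (rule prob_space_std_gaussian)
    note fm = borel_measurable_one_Lipschitz_scaled_cauchy[OF one_Lipschitz_radial]
    have fmc: "radial n \<in> borel_measurable (cauchy_measure \<beta> n)"
      using fm by (simp only: measurable_cong_sets[OF sets_cauchy_measure refl])
    interpret D: prob_space "distr (cauchy_measure \<beta> n) borel (radial n)"
      by (intro prob_space.prob_space_distr prob_space_cauchy_measure assms(1) fmc)
    show ?case
    proof (intro allI)
      fix c L :: real
      define I where "I = {c..c + L}"
      define J where "J = {c - 2 * \<delta>..c + L + 2 * \<delta>}"
      define K where "K = - {- R..R}"
      have [measurable]: "I \<in> sets borel" "J \<in> sets borel" "K \<in> sets borel"
        by (simp_all add: I_def J_def K_def)
      let ?m = "gaussian_mean n (radial n)"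
      let ?B = "\<lambda>t. {z \<in> space (std_gaussian {..<n}). radial n (\<lambda>i\<in>{..<n}. t * z i) \<in> I}"
      let ?C = "\<lambda>t. {z \<in> space (std_gaussian {..<n}). \<delta> < \<bar>radial n (\<lambda>i\<in>{..<n}. t * z i) - ?m t\<bar>}"
      \<comment> \<open>For \<open>t\<close> in \<open>{- R..R}\<close> outside \<open>J\<close>,
        the mean is more than \<open>\<delta>\<close> away from every point of \<open>I\<close>, so
        \<open>?B t\<close> is a deviation event; for all other \<open>t\<close> the indicators
        already give 1.\<close>
      have pt: "emeasure (std_gaussian {..<n}) (?B t) \<le> indicator J t + indicator K t + ennreal (e n)"
        if t: "0 \<le> t" for t
      proof (cases "t \<in> J \<or> t \<notin> {- R..R}")
        case True
        hence "(1 :: ennreal) \<le> indicator J t + indicator K t" by (auto simp: indicator_def K_def)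
        thus ?thesis using G.emeasure_le_1[of "?B t"] by (meson order_trans add_increasing2 zero_le)
      next
        case False
        note [measurable] = scale_measurable[OF elim(3) radial_lipschitz, of t]
        have "\<bar>?m t - t\<bar> \<le> t * (12 / real n)" by (rule gaussian_mean_radial[OF elim(3) t])
        also have "\<dots> \<le> R * (12 / real n)" using False by (intro mult_right_mono) auto
        finally have "\<bar>?m t - t\<bar> < \<delta>" using elim(2) by simp
        hence "?B t \<subseteq> ?C t" using False by (auto simp: I_def J_def)
        hence "emeasure (std_gaussian {..<n}) (?B t) \<le> emeasure (std_gaussian {..<n}) (?C t)"
          by (intro emeasure_mono) measurable
        also have "\<dots> \<le> ennreal (e n)"
          unfolding e_def using False t
          by (intro gaussian_mean_concentration[OF elim(3) radial_lipschitz] R assms(3)) auto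
        finally show ?thesis by (simp add: add_increasing)
      qed
      have "emeasure (distr (cauchy_measure \<beta> n) borel (radial n)) I
          = (\<integral>\<^sup>+t. emeasure (std_gaussian {..<n}) (?B t) \<partial>nu \<beta>)"
        by (rule emeasure_cauchy_measure[OF assms(1) fm]) measurable
      also have "\<dots> \<le> (\<integral>\<^sup>+t. indicator J t + indicator K t + ennreal (e n) \<partial>nu \<beta>)"
        by (intro nn_integral_mono pt) (simp add: space_nu)
      also have "\<dots> = (\<integral>\<^sup>+t. indicator J t + indicator K t + ennreal (e n) \<partial>nu_line \<beta>)"
        by (rule nn_integral_nu_line[symmetric]) measurable
      also have "\<dots> = emeasure (nu_line \<beta>) J + emeasure (nu_line \<beta>) K + ennreal (e n)"
        using nl.emeasure_space_1 by (simp add: nn_integral_add)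
      also have "emeasure (nu_line \<beta>) K = ennreal (1 - measure (nu_line \<beta>) {- R..R})"
        using nl.prob_compl[of "{- R..R}"] by (simp add: nl.emeasure_eq_measure Compl_eq_Diff_UNIV K_def)
      also have "emeasure (nu_line \<beta>) J + ennreal (1 - measure (nu_line \<beta>) {- R..R}) + ennreal (e n)
          = ennreal (measure (nu_line \<beta>) J + (1 - measure (nu_line \<beta>) {- R..R}) + e n)"
        using R(1) by (simp add: nl.emeasure_eq_measure e_def)
      finally have "measure (distr (cauchy_measure \<beta> n) borel (radial n)) I
          \<le> measure (nu_line \<beta>) J + (1 - measure (nu_line \<beta>) {- R..R}) + e n"
        unfolding D.emeasure_eq_measure using R(1)
        by (subst (asm) ennreal_le_iff) (auto simp: e_def intro!: add_nonneg_nonneg)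
      thus "measure (distr (cauchy_measure \<beta> n) borel (radial n)) {c..c + L} - \<epsilon>
          \<le> measure (nu_line \<beta>) {c - 2 * \<delta>..c + L + 2 * \<delta>}"
        using R(2) elim(1) by (simp add: I_def J_def)
    qed
  qed
qed

section \<open>Convergence of the observable diameters: the degenerate range of kappa and the two
  one-sided bounds\<close>

lemma obs_diam_trivial:
  assumes "1 \<le> \<kappa>"
  shows "obs_diam X \<kappa> = 0"
proof -
  \<comment> \<open>For \<open>1 - \<kappa> \<le> 0\<close> the empty set is admissible, and its
    diameter is 0.\<close>
  have "partial_diam (mm_line M) (1 - \<kappa>) \<le> ediam (\<lambda>x y. \<bar>x - y\<bar>) {}" for M
    unfolding partial_diam_def mm_line_def using assms by (intro INF_lower2[of "{}"]) auto
  hence "partial_diam (mm_line M) (1 - \<kappa>) \<le> 0" for M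
    by (simp add: ediam_def bot_ennreal)
  hence "obs_diam X \<kappa> \<le> 0" unfolding obs_diam_def by (intro SUP_least)
  thus ?thesis by simp
qed

theorem corollary1p7:
  fixes \<beta> \<kappa> :: real
  assumes "\<beta> > 0" and "\<kappa> > 0"
  shows "(\<lambda>n. obs_diam (mm_scale (1 / sqrt (real n)) (cauchy_space \<beta> n)) \<kappa>)
           \<longlonglongrightarrow> obs_diam (half_line_space \<beta>) \<kappa>"
proof (cases "\<kappa> < 1")
  case False
  thus ?thesis by (simp add: obs_diam_trivial)
next
  case True
  define \<alpha> where "\<alpha> = 1 - \<kappa>"
  have \<alpha>: "0 < \<alpha>" using True by (simp add: \<alpha>_def)
  interpret nl: prob_space "nu_line \<beta>" by (rule prob_space_nu_line) fact
  let ?D = "partial_diam (mm_line (nu_line \<beta>)) \<alpha>"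
  \<comment> \<open>The limit in \<open>ennreal\<close> is tested against arbitrary bounds; finite
    \<open>L < L'\<close> in between leave room for the errors in length.\<close>
  have gap: "\<exists>L L'. 0 \<le> L \<and> L < L' \<and> a < ennreal L \<and> ennreal L' < b" if "a < b" for a b :: ennreal
  proof -
    obtain l where l: "a < l" "l < b" using dense[OF \<open>a < b\<close>] by blast
    obtain l' where l': "l < l'" "l' < b" using dense[OF l(2)] by blast
    obtain L L' where "l = ennreal L" "0 \<le> L" "l' = ennreal L'" "0 \<le> L'"
      using l l' by (cases l; cases l') auto
    thus ?thesis using l l' by (intro exI[of _ L] exI[of _ L']) (auto simp: ennreal_less_iff)
  qed
  have "(\<lambda>n. obs_diam (scaled_cauchy \<beta> n) \<kappa>) \<longlonglongrightarrow> ?D"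
  proof (rule order_tendstoI)
    fix a assume "a < ?D"
    then obtain L L' where L: "0 \<le> L" "L < L'" "a < ennreal L" "ennreal L' < ?D" using gap by blast
    \<comment> \<open>Five parts: \<open>2 * \<delta>\<close> on each side in the radial comparison,
      and one \<open>\<delta>\<close> for the compactness argument.\<close>
    define \<delta> where "\<delta> = (L' - L) / 5"
    have \<delta>: "0 < \<delta>" "L' = L + 4 * \<delta> + \<delta>" using L by (auto simp: \<delta>_def field_simps)
    show "\<forall>\<^sub>F n in sequentially. a < obs_diam (scaled_cauchy \<beta> n) \<kappa>"
    proof (rule ccontr)
      assume "\<not> ?thesis"
      \<comment> \<open>Failure for infinitely many \<open>n\<close> suffices: each
        \<open>\<epsilon>\<close> asks for only one such \<open>n\<close> beyond the threshold of
        the radial comparison.\<close>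
      hence freq: "\<exists>\<^sub>F n in sequentially. \<not> a < obs_diam (scaled_cauchy \<beta> n) \<kappa>"
        by (simp add: not_eventually)
      have "\<exists>c. \<alpha> - \<epsilon> \<le> measure (nu_line \<beta>) {c..c + (L + 4 * \<delta>)}" if "0 < \<epsilon>" for \<epsilon>
      proof -
        obtain n where n: "\<not> a < obs_diam (scaled_cauchy \<beta> n) \<kappa>"
          and le: "\<And>c L. measure (distr (cauchy_measure \<beta> n) borel (radial n)) {c..c + L} - \<epsilon>
            \<le> measure (nu_line \<beta>) {c - 2 * \<delta>..c + L + 2 * \<delta>}"
          using frequently_eventually_conj[OF freq radial_cauchy_measure_le[OF assms(1) \<open>0 < \<epsilon>\<close> \<delta>(1)]]
          by (auto dest: frequently_ex)
        have fmc: "radial n \<in> borel_measurable (cauchy_measure \<beta> n)"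
          using borel_measurable_one_Lipschitz_scaled_cauchy[OF one_Lipschitz_radial]
          by (simp only: measurable_cong_sets[OF sets_cauchy_measure refl])
        have "partial_diam (mm_line (distr (cauchy_measure \<beta> n) borel (radial n))) \<alpha> \<le> obs_diam (scaled_cauchy \<beta> n) \<kappa>"
          unfolding obs_diam_def \<alpha>_def using one_Lipschitz_radial
          by (intro SUP_upper2[of "radial n"]) (simp_all add: mm_scale_def cauchy_space_def)
        also have "\<dots> < ennreal L" using n L(3) by simp
        finally obtain c where "\<alpha> \<le> measure (distr (cauchy_measure \<beta> n) borel (radial n)) {c..c + L}"
          using partial_diam_line_less[OF prob_space.prob_space_distr[OF prob_space_cauchy_measure[OF assms(1)] fmc] _ \<alpha>]
          by auto
        with le[of c L] have "\<alpha> - \<epsilon> \<le> measure (nu_line \<beta>) {c - 2 * \<delta>..c - 2 * \<delta> + (L + 4 * \<delta>)}"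
          by (simp add: algebra_simps)
        thus ?thesis by blast
      qed
      then obtain c where "\<alpha> \<le> measure (nu_line \<beta>) {c..c + (L + 4 * \<delta> + \<delta>)}"
        using interval_measure_limit[OF nl.prob_space_axioms sets_nu_line \<alpha> \<delta>(1)] by blast
      hence "?D \<le> ennreal L'"
        using L unfolding \<delta>(2)[symmetric] by (intro partial_diam_line_le) auto
      thus False using L(4) by simp
    qed
  next
    fix a assume "?D < a"
    then obtain L L' where L: "0 \<le> L" "L < L'" "?D < ennreal L" "ennreal L' < a" using gap by blast
    \<comment> \<open>Three parts: one \<open>\<delta>\<close> buys strictly more mass, two are
      spent on concentration.\<close>
    define \<delta> where "\<delta> = (L' - L) / 3"
    have \<delta>: "0 < \<delta>" "L' = L + \<delta> + 2 * \<delta>" using L by (auto simp: \<delta>_def field_simps)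
    obtain c where c: "\<alpha> \<le> measure (nu_line \<beta>) {c..c + L}"
      using partial_diam_line_less[OF nl.prob_space_axioms sets_nu_line \<alpha> L(3)] by blast
    \<comment> \<open>Otherwise the interval would miss the half-line and carry no mass. Hence the
      piece added on the right meets the open half-line.\<close>
    have "0 \<le> c + L"
    proof (rule ccontr)
      assume "\<not> 0 \<le> c + L"
      hence "{c..c + L} \<inter> {0..} = {}" by auto
      thus False using c \<alpha> by (simp add: measure_nu_line)
    qed
    hence "0 < measure (nu_line \<beta>) {c + L<..<c + (L + \<delta>)}"
      using \<delta> assms(1) by (intro nu_line_Ioo_pos) auto
    moreover have "measure (nu_line \<beta>) {c..c + L} + measure (nu_line \<beta>) {c + L<..<c + (L + \<delta>)}
        = measure (nu_line \<beta>) ({c..c + L} \<union> {c + L<..<c + (L + \<delta>)})"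
      by (intro nl.finite_measure_Union[symmetric]) auto
    moreover have "\<dots> \<le> measure (nu_line \<beta>) {c..c + (L + \<delta>)}"
      using \<delta> L by (intro nl.finite_measure_mono) auto
    ultimately have "1 - \<kappa> < measure (nu_line \<beta>) {c..c + (L + \<delta>)}"
      using c by (simp add: \<alpha>_def)
    hence "\<forall>\<^sub>F n in sequentially. obs_diam (scaled_cauchy \<beta> n) \<kappa> \<le> ennreal (L + \<delta> + 2 * \<delta>)"
      using assms(1) \<delta> L by (intro obs_diam_cauchy_upper) auto
    thus "\<forall>\<^sub>F n in sequentially. obs_diam (scaled_cauchy \<beta> n) \<kappa> < a"
      by eventually_elim (use L(4) \<delta>(2) in auto)
  qed
  thus ?thesis unfolding obs_diam_half_line_space[OF assms(1) True] \<alpha>_def .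
qed

end
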